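(* Let $\textsc{parity}_d:\{-1,1\}^d\to\{-1,1\}$ be the parity function $\textsc{parity}_d(u_0,\dots,u_{d-1})=u_0u_1\cdots u_{d-1}$. If $k<d$, then $\beta_{i,\dagger}(\textsc{polythr}^k_d\cup\{\textsc{parity}_d\})=0$ for all $i$.
   Context: $\textsc{polythr}^k_d$ is the set of functions $\{-1,1\}^d\to\{-1,1\}$ of the form $u\mapsto\operatorname{sgn}(p(u))$ with $p$ a real polynomial of degree at most $k$ in $d$ variables not vanishing at any point of $\{-1,1\}^d$. Fix a field $\Bbbk$. Let $\mathcal U=\{-1,1\}^d$ and $S=\Bbbk[x_{u,a}:u\in\mathcal U,\ a\in\{-1,1\}]$. For a partial function $\mathsf f$ from $\mathcal U$ to $\{-1,1\}$ let $\Gamma\mathsf f=(\mathcal U\times\{-1,1\})\setminus\operatorname{graph}\mathsf f$, and $\mathbf x^\sigma=\prod_{(u,a)\in\sigma}x_{u,a}$. For a class $\mathtt C$ of functions $\mathcal U\to\{-1,1\}$, its canonical ideal is $I^\star_{\mathtt C}=\langle\mathbf x^{\Gamma f}:f\in\mathtt C\rangle\subseteq S$, and $\beta_{i,\mathsf f}(\mathtt C)$ is the $i$-th multigraded Betti number $\dim_\Bbbk\operatorname{Tor}^S_i(\Bbbk,I^\star_{\mathtt C})$ in the squarefree degree $\Gamma\mathsf f$. $\dagger$ denotes the partial function with empty domain. *)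

theory Defs
  imports Complex_Main "HOL-Library.Poly_Mapping" "HOL-Library.Cardinality"
begin

section \<open>Polynomial rings and ideals\<close>

text \<open>
  An exponent vector is a finitely supported function \<^typ>\<open>'v \<Rightarrow>\<^sub>0 nat\<close>, and a polynomial is
  a finitely supported function from exponent vectors to coefficients; multiplication of
  \<^type>\<open>poly_mapping\<close> is convolution, so this is the polynomial ring in the variables \<^typ>\<open>'v\<close>.
\<close>

type_synonym 'v expo = "'v \<Rightarrow>\<^sub>0 nat"
type_synonym ('v, 'k) mpoly = "'v expo \<Rightarrow>\<^sub>0 'k"

definition Var :: "'v \<Rightarrow> ('v, 'k::comm_semiring_1) mpoly" where
  "Var v = Poly_Mapping.single (Poly_Mapping.single v 1) 1"

definition eval_mpoly :: "('v \<Rightarrow> 'k) \<Rightarrow> ('v::finite, 'k::comm_semiring_1) mpoly \<Rightarrow> 'k" where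
  "eval_mpoly a p = (\<Sum>m\<in>Poly_Mapping.keys p.
     Poly_Mapping.lookup p m * (\<Prod>v\<in>UNIV. a v ^ Poly_Mapping.lookup m v))"

definition total_degree_le :: "('v::finite, 'k::zero) mpoly \<Rightarrow> nat \<Rightarrow> bool" where
  "total_degree_le p n \<longleftrightarrow>
     (\<forall>m\<in>Poly_Mapping.keys p. (\<Sum>v\<in>UNIV. Poly_Mapping.lookup m v) \<le> n)"

interpretation self: module "(*) :: 'a::comm_ring_1 \<Rightarrow> 'a \<Rightarrow> 'a"
  by unfold_locales (simp_all add: algebra_simps)

definition ideal_gen :: "'a::comm_ring_1 set \<Rightarrow> 'a set" where
  "ideal_gen G = self.span G"

section \<open>Multigraded free resolutions of the residue field\<close>

text \<open>
  The elements of \<^typ>\<open>nat \<Rightarrow>\<^sub>0 ('v, 'k) mpoly\<close> are the finitely supported families of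
  polynomials; those supported in a set \<open>J\<close> form the free module with basis \<open>J\<close>.
\<close>

definition smul :: "'a::comm_ring_1 \<Rightarrow> (nat \<Rightarrow>\<^sub>0 'a) \<Rightarrow> (nat \<Rightarrow>\<^sub>0 'a)" where
  "smul s x = Poly_Mapping.map ((*) s) x"

lemma lookup_smul [simp]: "Poly_Mapping.lookup (smul s x) j = s * Poly_Mapping.lookup x j"
  by (simp add: smul_def Poly_Mapping.map.rep_eq when_def)

interpretation free: module "smul :: 'a::comm_ring_1 \<Rightarrow> _"
  by (unfold_locales; rule poly_mapping_eqI)
     (simp_all only: lookup_smul lookup_add distrib_left distrib_right mult.assoc mult_1)

definition kscale :: "'k::field \<Rightarrow> (nat \<Rightarrow>\<^sub>0 ('v, 'k) mpoly) \<Rightarrow> (nat \<Rightarrow>\<^sub>0 ('v, 'k) mpoly)" where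
  "kscale c = smul (Poly_Mapping.single 0 c)"

interpretation kspace: vector_space "kscale :: 'k::field \<Rightarrow> (nat \<Rightarrow>\<^sub>0 ('v, 'k) mpoly) \<Rightarrow> _"
  by unfold_locales
     (simp_all add: kscale_def free.scale_right_distrib free.scale_left_distrib
        single_add mult_single)

text \<open>The residue field as a module: each variable acts as zero.\<close>

definition residue_scale :: "('v, 'k::field) mpoly \<Rightarrow> 'k \<Rightarrow> 'k" where
  "residue_scale p c = Poly_Mapping.lookup p 0 * c"

text \<open>
  In homological degree \<open>i\<close> the module has basis \<open>gens R i\<close>, the basis element \<open>j\<close> having
  multidegree \<open>gdeg R i j\<close>. The map \<open>diff R i\<close> goes from homological degree \<open>i + 1\<close> to
  homological degree \<open>i\<close>; only its values on the module with basis \<open>gens R (Suc i)\<close> matter.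
\<close>

record (overloaded) ('v, 'k) graded_complex =
  gens :: "nat \<Rightarrow> nat set"
  gdeg :: "nat \<Rightarrow> nat \<Rightarrow> 'v expo"
  diff :: "nat \<Rightarrow> (nat \<Rightarrow>\<^sub>0 ('v, 'k) mpoly) \<Rightarrow> (nat \<Rightarrow>\<^sub>0 ('v, 'k) mpoly)"
  augm :: "(nat \<Rightarrow>\<^sub>0 ('v, 'k) mpoly) \<Rightarrow> 'k"

text \<open>
  For a free module \<open>F\<close> with basis \<open>J\<close> and an ideal \<open>N\<close>, the tensor product of \<open>F\<close> and \<open>N\<close> is
  the module of families in \<open>N\<close> supported in \<open>J\<close>, and tensoring a linear map between free
  modules with \<open>N\<close> restricts it to such families. For \<open>N = UNIV\<close> this is \<open>F\<close> itself.
\<close>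

definition tensor :: "('v, 'k::zero) graded_complex \<Rightarrow> ('v, 'k) mpoly set \<Rightarrow> nat
    \<Rightarrow> (nat \<Rightarrow>\<^sub>0 ('v, 'k) mpoly) set" where
  "tensor R N i = {x. Poly_Mapping.keys x \<subseteq> gens R i \<and> (\<forall>j. Poly_Mapping.lookup x j \<in> N)}"

definition tensor_deg :: "('v, 'k::zero) graded_complex \<Rightarrow> ('v, 'k) mpoly set \<Rightarrow> nat \<Rightarrow> 'v expo
    \<Rightarrow> (nat \<Rightarrow>\<^sub>0 ('v, 'k) mpoly) set" where
  "tensor_deg R N i b = {x \<in> tensor R N i.
     \<forall>j. \<forall>m\<in>Poly_Mapping.keys (Poly_Mapping.lookup x j). m + gdeg R i j = b}"

definition is_residue_resolution :: "('v, 'k::field) graded_complex \<Rightarrow> bool" where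
  "is_residue_resolution R \<longleftrightarrow>
     (\<forall>i. finite (gens R i)) \<and>
     (\<forall>i. module_hom smul smul (diff R i)) \<and>
     (\<forall>i b. diff R i ` tensor_deg R UNIV (Suc i) b \<subseteq> tensor_deg R UNIV i b) \<and>
     module_hom smul residue_scale (augm R) \<and>
     (\<forall>b. b \<noteq> 0 \<longrightarrow> augm R ` tensor_deg R UNIV 0 b \<subseteq> {0}) \<and>
     augm R ` tensor R UNIV 0 = UNIV \<and>
     diff R 0 ` tensor R UNIV 1 = {x \<in> tensor R UNIV 0. augm R x = 0} \<and>
     (\<forall>i. diff R (Suc i) ` tensor R UNIV (Suc (Suc i)) =
            {x \<in> tensor R UNIV (Suc i). diff R i x = 0})"

section \<open>Tor and Betti numbers\<close>

definition cycles :: "('v, 'k::field) graded_complex \<Rightarrow> ('v, 'k) mpoly set \<Rightarrow> nat \<Rightarrow> 'v expo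
    \<Rightarrow> (nat \<Rightarrow>\<^sub>0 ('v, 'k) mpoly) set" where
  "cycles R N i b =
     {x \<in> tensor_deg R N i b. case i of 0 \<Rightarrow> True | Suc j \<Rightarrow> diff R j x = 0}"

definition boundaries :: "('v, 'k::field) graded_complex \<Rightarrow> ('v, 'k) mpoly set \<Rightarrow> nat \<Rightarrow> 'v expo
    \<Rightarrow> (nat \<Rightarrow>\<^sub>0 ('v, 'k) mpoly) set" where
  "boundaries R N i b = diff R i ` tensor_deg R N (Suc i) b"

lemma linear_on_ideal:
  fixes d :: "(nat \<Rightarrow>\<^sub>0 'a::comm_ring_1) \<Rightarrow> (nat \<Rightarrow>\<^sub>0 'a)"
  assumes d: "module_hom smul smul d" and N: "self.subspace N"
    and x: "\<forall>j. Poly_Mapping.lookup x j \<in> N"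
  shows "\<forall>j. Poly_Mapping.lookup (d x) j \<in> N"
proof -
  interpret d: module_hom smul smul d by (rule d)
  have "x = (\<Sum>l\<in>Poly_Mapping.keys x.
          smul (Poly_Mapping.lookup x l) (Poly_Mapping.single l 1))"
  proof (rule poly_mapping_eqI)
    fix k
    have "(\<Sum>l\<in>Poly_Mapping.keys x. Poly_Mapping.lookup x l * (1 when l = k)) =
          (\<Sum>l\<in>Poly_Mapping.keys x. if l = k then Poly_Mapping.lookup x l else 0)"
      by (rule sum.cong) auto
    also have "\<dots> = Poly_Mapping.lookup x k"
      by (simp add: in_keys_iff)
    finally show "Poly_Mapping.lookup x k = Poly_Mapping.lookup (\<Sum>l\<in>Poly_Mapping.keys x.
          smul (Poly_Mapping.lookup x l) (Poly_Mapping.single l 1)) k"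
      by (simp only: lookup_sum lookup_smul lookup_single)
  qed
  then have "d x = d (\<Sum>l\<in>Poly_Mapping.keys x.
          smul (Poly_Mapping.lookup x l) (Poly_Mapping.single l 1))"
    by (rule arg_cong)
  also have "\<dots> = (\<Sum>l\<in>Poly_Mapping.keys x.
          smul (Poly_Mapping.lookup x l) (d (Poly_Mapping.single l 1)))"
    by (simp only: d.sum d.scale)
  finally have "d x = (\<Sum>l\<in>Poly_Mapping.keys x.
          smul (Poly_Mapping.lookup x l) (d (Poly_Mapping.single l 1)))" .
  then have "Poly_Mapping.lookup (d x) j = (\<Sum>l\<in>Poly_Mapping.keys x.
          Poly_Mapping.lookup (d (Poly_Mapping.single l 1)) j * Poly_Mapping.lookup x l)" for j
    by (simp only: lookup_sum lookup_smul mult.commute)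
  then show ?thesis
    using x N by (simp add: self.subspace_sum self.subspace_scale)
qed

lemma boundaries_subset_cycles:
  assumes R: "is_residue_resolution R" and N: "self.subspace N"
  shows "boundaries R N i b \<subseteq> cycles R N i b"
proof
  note R' = R[unfolded is_residue_resolution_def]
  have lin: "\<forall>i. module_hom smul smul (diff R i)"
    using R' by (elim conjE)
  have hom: "\<forall>i b. diff R i ` tensor_deg R UNIV (Suc i) b \<subseteq> tensor_deg R UNIV i b"
    using R' by (elim conjE)
  have exact: "\<forall>i. diff R (Suc i) ` tensor R UNIV (Suc (Suc i)) =
      {x \<in> tensor R UNIV (Suc i). diff R i x = 0}"
    using R' by (elim conjE)
  fix y assume "y \<in> boundaries R N i b"
  then obtain x where x: "x \<in> tensor_deg R N (Suc i) b" and y: "y = diff R i x"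
    unfolding boundaries_def by blast
  have xN: "\<forall>j. Poly_Mapping.lookup x j \<in> N"
    using x unfolding tensor_deg_def tensor_def by blast
  have xU: "x \<in> tensor_deg R UNIV (Suc i) b"
    using x unfolding tensor_deg_def tensor_def by blast
  have "\<forall>j. Poly_Mapping.lookup y j \<in> N"
    unfolding y by (rule linear_on_ideal[OF lin[rule_format] N xN])
  moreover have "y \<in> tensor_deg R UNIV i b"
    unfolding y using hom xU by blast
  ultimately have deg: "y \<in> tensor_deg R N i b"
    unfolding tensor_deg_def tensor_def by blast
  show "y \<in> cycles R N i b"
  proof (cases i)
    case 0
    with deg show ?thesis by (simp add: cycles_def)
  next
    case (Suc j)
    have "x \<in> tensor R UNIV (Suc (Suc j))"
      using xU unfolding Suc tensor_deg_def by blast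
    then have "y \<in> diff R (Suc j) ` tensor R UNIV (Suc (Suc j))"
      unfolding y Suc by blast
    then have "diff R j y = 0"
      unfolding exact[rule_format] by blast
    with deg Suc show ?thesis by (simp add: cycles_def)
  qed
qed

text \<open>
  The dimension in multidegree \<open>b\<close> of the \<open>i\<close>-th left derived functor of tensoring with the
  homogeneous ideal \<open>N\<close>, applied to the residue field: choose a resolution \<open>R\<close> of the residue
  field, tensor it with \<open>N\<close>, and take the dimension of cycles modulo boundaries. Up to
  isomorphism the homology does not depend on \<open>R\<close>, and a suitable \<open>R\<close> exists when \<^typ>\<open>'v\<close> is
  finite (for example the Koszul complex). Every space involved is finite-dimensional, since
  the modules of \<open>R\<close> have finite rank and each generator contributes at most one dimension in
  multidegree \<open>b\<close>; the subtraction does not truncate, by the lemma \<open>boundaries_subset_cycles\<close>.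
\<close>

definition tor_dim :: "nat \<Rightarrow> ('v, 'k::field) mpoly set \<Rightarrow> 'v expo \<Rightarrow> nat" where
  "tor_dim i N b = (let R = (SOME R. is_residue_resolution R)
     in kspace.dim (cycles R N i b) - kspace.dim (boundaries R N i b))"

section \<open>The canonical ideal of a class of functions\<close>

typedef sign = "{-1, 1 :: int}" morphisms sign_val Sign
  by blast

instance sign :: finite
proof
  have "(UNIV :: sign set) = Sign ` {-1, 1}"
    by (rule type_definition.Abs_image[OF type_definition_sign, symmetric])
  then show "finite (UNIV :: sign set)" by (rule ssubst) simp
qed

definition Gam :: "('u \<rightharpoonup> sign) \<Rightarrow> ('u \<times> sign) set" where
  "Gam f = UNIV - Map.graph f"

definition var_prod :: "'v set \<Rightarrow> ('v, 'k::comm_semiring_1) mpoly" where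
  "var_prod \<sigma> = (\<Prod>v\<in>\<sigma>. Var v)"

definition squarefree_deg :: "'v set \<Rightarrow> 'v expo" where
  "squarefree_deg \<sigma> = (\<Sum>v\<in>\<sigma>. Poly_Mapping.single v 1)"

definition canonical_ideal :: "('u \<Rightarrow> sign) set \<Rightarrow> ('u \<times> sign, 'k::field) mpoly set" where
  "canonical_ideal C = ideal_gen ((\<lambda>f. var_prod (Gam (\<lambda>u. Some (f u)))) ` C)"

definition betti :: "'k::field itself \<Rightarrow> nat \<Rightarrow> ('u \<rightharpoonup> sign) \<Rightarrow> ('u \<Rightarrow> sign) set \<Rightarrow> nat" where
  "betti _ i f C = tor_dim i (canonical_ideal C :: ('u \<times> sign, 'k) mpoly set)
     (squarefree_deg (Gam f))"

section \<open>Polynomial threshold functions and parity\<close>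

text \<open>The cube \<open>{-1,1}^d\<close> is the type \<^typ>\<open>'n::finite \<Rightarrow> sign\<close> with \<open>d = CARD('n)\<close>.\<close>

definition polythr :: "nat \<Rightarrow> (('n::finite \<Rightarrow> sign) \<Rightarrow> sign) set" where
  "polythr k = {f. \<exists>p :: ('n, real) mpoly. total_degree_le p k \<and>
     (\<forall>u. eval_mpoly (\<lambda>i. real_of_int (sign_val (u i))) p \<noteq> 0) \<and>
     (\<forall>u. real_of_int (sign_val (f u)) = sgn (eval_mpoly (\<lambda>i. real_of_int (sign_val (u i))) p))}"

definition parity :: "('n::finite \<Rightarrow> sign) \<Rightarrow> sign" where
  "parity u = Sign (\<Prod>i\<in>UNIV. sign_val (u i))"

lemma sign_val_parity:
  fixes u :: "'n::finite \<Rightarrow> sign"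
  shows "sign_val (parity u) = (\<Prod>i\<in>UNIV. sign_val (u i))"
proof -
  have "(\<Prod>i\<in>A. sign_val (u i)) \<in> {-1, 1}" if "finite A" for A :: "'n set"
    using that
  proof (induction A rule: finite_induct)
    case (insert x A)
    then show ?case using sign_val[of "u x"] by auto
  qed simp
  then show ?thesis
    unfolding parity_def by (intro Sign_inverse) auto
qed

end

theory Submission
  imports Defs "HOL-Library.Countable" "HOL-Library.FuncSet"
begin

text \<open>
  The squarefree multidegree belonging to the partial function with empty domain is the all-ones
  vector. By Hochster's formula, the Betti numbers of the canonical ideal in this multidegree
  are the dimensions of the reduced homology of the simplicial complex on the vertices \<open>(u, s)\<close>
  whose facets are the graphs of the functions in the class. So the claim is that this complex
  is acyclic.

  Threshold functions alone give the complex of all partial sign patterns realised by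
  polynomials of degree at most \<open>k\<close>. This is the nerve of the cover of the space of nonzero
  polynomial functions by the open half-spaces \<open>{p. s * p u > 0}\<close>, so it is a homology sphere.
  Parity adds one simplex, attached along the patterns that a polynomial shares with parity.
  Since parity is orthogonal to all polynomials of degree less than the dimension
  (\<open>parity_orthogonal\<close>), a nonzero polynomial function agrees in sign with parity somewhere.
  So the half-spaces of the vertices of parity already cover the nonzero polynomial functions,
  the attaching complex is the same homology sphere, and the new simplex fills it.

  The formal argument avoids both the nerve theorem and the homology of spheres. It starts from
  the simplex of parity and attaches the other vertices \<open>v = (u, s)\<close> one after another
  (\<open>tor_acyclic_Pow_Un_pos_complex\<close>). Each is attached along its link, which is the nerve of the
  half-space of \<open>v\<close>, a convex set, covered by the half-spaces of the vertices of parity. Such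
  nerves are acyclic (\<open>tor_acyclic_pos_complex\<close>), by induction on the number of half-spaces:
  one cuts the convex set along a hyperplane.

  Besides the triviality of the empty complex, only three facts about homology enter: simplices on a nonempty vertex set are acyclic, cones
  are acyclic, and the union of two acyclic complexes with acyclic intersection is acyclic. They
  are proved directly for the Tor modules of the ideals, from an arbitrary resolution of the
  residue field (\<open>tor_acyclic_Pow\<close>, \<open>tor_acyclic_common_vertex\<close>, \<open>tor_acyclic_Un\<close>). Hochster's
  formula and the comparison of different resolutions are thereby bypassed, and the only
  explicit resolution is the Koszul complex, as a witness that one exists
  (\<open>koszul_resolution\<close>).
\<close>

(* This simplification rule, inherited from the ring viewed as a module over itself, is the
   reverse of mult.assoc, and rewriting with both does not terminate. *)
declare self.scale_scale [simp del]

section \<open>Monomials and multidegrees\<close>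

lemma lookup_single_mult_add:
  fixes p :: "'a::cancel_comm_monoid_add \<Rightarrow>\<^sub>0 'b::comm_semiring_1"
  shows "Poly_Mapping.lookup (Poly_Mapping.single e c * p) (e + k) = c * Poly_Mapping.lookup p k"
  by (simp add: lookup_mult lookup_single when_mult)

lemma lookup_single_mult_eq_0:
  fixes p :: "'a::cancel_comm_monoid_add \<Rightarrow>\<^sub>0 'b::comm_semiring_1"
  assumes "\<And>k. m \<noteq> e + k"
  shows "Poly_Mapping.lookup (Poly_Mapping.single e c * p) m = 0"
  using assms by (simp add: lookup_mult lookup_single when_mult)

lemma expo_split:
  fixes e m :: "'v \<Rightarrow>\<^sub>0 nat"
  assumes "\<And>v. Poly_Mapping.lookup e v \<le> Poly_Mapping.lookup m v"
  obtains k where "m = e + k"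
proof
  show "m = e + (m - e)"
    using assms by (intro poly_mapping_eqI) (simp add: lookup_add lookup_minus)
qed

lemma lookup_squarefree_deg:
  fixes \<sigma> :: "'v::finite set"
  shows "Poly_Mapping.lookup (squarefree_deg \<sigma>) v = (if v \<in> \<sigma> then 1 else 0)"
  by (simp add: squarefree_deg_def lookup_sum lookup_single when_def)

lemma squarefree_deg_insert:
  fixes \<sigma> :: "'v::finite set"
  assumes "v \<notin> \<sigma>"
  shows "squarefree_deg (insert v \<sigma>) = Poly_Mapping.single v 1 + squarefree_deg \<sigma>"
  using assms by (simp add: squarefree_deg_def)

lemma lookup_sum_single:
  assumes "finite A" "Poly_Mapping.keys p \<subseteq> A"
  shows "p = (\<Sum>m\<in>A. Poly_Mapping.single m (Poly_Mapping.lookup p m))"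
proof (rule poly_mapping_eqI)
  fix k show "Poly_Mapping.lookup p k =
      Poly_Mapping.lookup (\<Sum>m\<in>A. Poly_Mapping.single m (Poly_Mapping.lookup p m)) k"
    using assms by (auto simp: lookup_sum lookup_single when_def in_keys_iff)
qed

section \<open>Squarefree monomial ideals and simplicial complexes\<close>

text \<open>
  A monomial \<open>m\<close> lies in the ideal generated by the squarefree monomials with variable sets
  \<open>- \<tau>\<close>, for \<open>\<tau>\<close> in a simplicial complex \<open>K\<close>, exactly when its zero set is a face of \<open>K\<close>. Testing
  zero sets is a condition on single monomials, so unions and intersections of complexes turn
  into sums and intersections of ideals with no computation of generators.
\<close>
definition zeros :: "'v expo \<Rightarrow> 'v set" where
  "zeros m = {v. Poly_Mapping.lookup m v = 0}"

lemma zeros_add: "zeros (m + n) = zeros m \<inter> zeros n"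
  by (auto simp: zeros_def lookup_add)

definition complex_ideal :: "'v set set \<Rightarrow> ('v, 'k::zero) mpoly set" where
  "complex_ideal K = {p. \<forall>m\<in>Poly_Mapping.keys p. zeros m \<in> K}"

definition down_closed :: "'v set set \<Rightarrow> bool" where
  "down_closed K \<longleftrightarrow> (\<forall>\<sigma>\<in>K. Pow \<sigma> \<subseteq> K)"

lemma down_closed_Un: "down_closed A \<Longrightarrow> down_closed B \<Longrightarrow> down_closed (A \<union> B)"
  and down_closed_Int: "down_closed A \<Longrightarrow> down_closed B \<Longrightarrow> down_closed (A \<inter> B)"
  and down_closed_Pow: "down_closed (Pow \<sigma>)"
  and down_closed_UN_Pow: "down_closed (\<Union>i\<in>F. Pow (h i))"
  by (auto simp: down_closed_def)

lemma complex_ideal_iff: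
  "p \<in> complex_ideal K \<longleftrightarrow> (\<forall>m. Poly_Mapping.lookup p m \<noteq> 0 \<longrightarrow> zeros m \<in> K)"
  by (auto simp: complex_ideal_def in_keys_iff)

text \<open>Multiplying by a monomial shrinks the zero set, so closure under subsets is what makes
  \<open>complex_ideal K\<close> an ideal.\<close>
lemma subspace_complex_ideal:
  assumes "down_closed K"
  shows "self.subspace (complex_ideal K :: ('v, 'k::comm_ring_1) mpoly set)"
proof (rule self.subspaceI)
  fix p q :: "('v, 'k) mpoly"
  assume "p \<in> complex_ideal K" "q \<in> complex_ideal K"
  then show "p + q \<in> complex_ideal K"
    using keys_add[of p q] unfolding complex_ideal_def by blast
next
  fix c p :: "('v, 'k) mpoly"
  assume p: "p \<in> complex_ideal K"
  show "c * p \<in> complex_ideal K"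
    unfolding complex_ideal_def
  proof safe
    fix m assume "m \<in> Poly_Mapping.keys (c * p)"
    then obtain a b where "m = a + b" "b \<in> Poly_Mapping.keys p"
      using keys_mult[of c p] by blast
    then have "zeros m \<subseteq> zeros b" "zeros b \<in> K"
      using p by (auto simp: zeros_add complex_ideal_def)
    then show "zeros m \<in> K"
      using assms by (auto simp: down_closed_def)
  qed
qed (simp add: complex_ideal_def)

lemma var_prod_eq_single:
  fixes \<sigma> :: "'v::finite set"
  shows "var_prod \<sigma> = Poly_Mapping.single (squarefree_deg \<sigma>) (1 :: 'k::comm_semiring_1)"
proof (induction \<sigma> rule: finite_induct[OF finite])
  case (2 v \<sigma>)
  then show ?case
    by (simp add: var_prod_def Var_def mult_single squarefree_deg_insert)
qed (simp add: var_prod_def squarefree_deg_def)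

text \<open>The generator of \<open>f\<close> has exponent one outside the graph of \<open>f\<close>, so its zero set is the graph;
  the complex of the class therefore has the graphs as facets.\<close>
lemma canonical_ideal_eq:
  fixes C :: "('u::finite \<Rightarrow> sign) set"
  shows "(canonical_ideal C :: ('u \<times> sign, 'k::field) mpoly set) =
    complex_ideal (\<Union>f\<in>C. Pow (Map.graph (\<lambda>u. Some (f u))))" (is "_ = complex_ideal ?K")
proof
  let ?g = "\<lambda>f. var_prod (Gam (\<lambda>u. Some (f u))) :: ('u \<times> sign, 'k) mpoly"
  have zeros_gen: "zeros (squarefree_deg (Gam h)) = Map.graph h" for h :: "'u \<rightharpoonup> sign"
    by (auto simp: zeros_def lookup_squarefree_deg Gam_def split: if_splits)
  show "(canonical_ideal C :: ('u \<times> sign, 'k::field) mpoly set) \<subseteq> complex_ideal ?K"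
    unfolding canonical_ideal_def ideal_gen_def
  proof (rule self.span_minimal)
    show "?g ` C \<subseteq> complex_ideal ?K"
      by (auto simp: complex_ideal_def var_prod_eq_single zeros_gen)
    show "self.subspace (complex_ideal ?K :: ('u \<times> sign, 'k) mpoly set)"
      by (rule subspace_complex_ideal[OF down_closed_UN_Pow])
  qed
  show "complex_ideal ?K \<subseteq> (canonical_ideal C :: ('u \<times> sign, 'k::field) mpoly set)"
  proof
    fix p :: "('u \<times> sign, 'k) mpoly"
    assume p: "p \<in> complex_ideal ?K"
    have "Poly_Mapping.single m (Poly_Mapping.lookup p m) \<in> self.span (?g ` C)"
      if "m \<in> Poly_Mapping.keys p" for m
    proof -
      have "zeros m \<in> ?K"
        using p that by (simp only: complex_ideal_def mem_Collect_eq)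
      then obtain f where f: "f \<in> C" "zeros m \<subseteq> Map.graph (\<lambda>u. Some (f u))"
        by blast
      let ?e = "squarefree_deg (Gam (\<lambda>u. Some (f u)))"
      have "Poly_Mapping.lookup ?e v \<le> Poly_Mapping.lookup m v" for v
        using subsetD[OF f(2), of v]
        by (cases "v \<in> Map.graph (\<lambda>u. Some (f u))")
          (auto simp: lookup_squarefree_deg Gam_def zeros_def Suc_le_eq)
      then obtain k where k: "m = ?e + k"
        by (rule expo_split)
      have "Poly_Mapping.single k (Poly_Mapping.lookup p m) * ?g f \<in> self.span (?g ` C)"
        using f(1) by (intro self.span_scale self.span_base) blast
      then show ?thesis
        by (subst (asm) var_prod_eq_single) (simp add: mult_single k add.commute)
    qed
    then show "p \<in> canonical_ideal C"
      unfolding canonical_ideal_def ideal_gen_def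
      by (subst lookup_sum_single[OF finite_keys subset_refl]) (rule self.span_sum)
  qed
qed

section \<open>Vanishing of Tor in the all-ones multidegree\<close>

lemma tensor_iff:
  "x \<in> tensor R N i \<longleftrightarrow> (\<forall>j. Poly_Mapping.lookup x j \<in> N) \<and>
     (\<forall>j. Poly_Mapping.lookup x j \<noteq> 0 \<longrightarrow> j \<in> gens R i)"
  by (auto simp: tensor_def in_keys_iff)

lemma tensor_deg_iff:
  "x \<in> tensor_deg R N i b \<longleftrightarrow> (\<forall>j. Poly_Mapping.lookup x j \<in> N) \<and>
     (\<forall>j m. Poly_Mapping.lookup (Poly_Mapping.lookup x j) m \<noteq> 0 \<longrightarrow>
        j \<in> gens R i \<and> m + gdeg R i j = b)"
proof -
  have "Poly_Mapping.lookup x j \<noteq> 0 \<longleftrightarrow> (\<exists>m. Poly_Mapping.lookup (Poly_Mapping.lookup x j) m \<noteq> 0)"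
    for j by (metis lookup_zero poly_mapping_eqI)
  then show ?thesis
    unfolding tensor_deg_def mem_Collect_eq tensor_iff in_keys_iff Ball_def by blast
qed

lemma lookup_lookup_nonzero_add:
  assumes "Poly_Mapping.lookup (Poly_Mapping.lookup (x + y) j) m \<noteq> 0"
  shows "Poly_Mapping.lookup (Poly_Mapping.lookup x j) m \<noteq> 0 \<or>
    Poly_Mapping.lookup (Poly_Mapping.lookup y j) m \<noteq> 0"
  using assms by (auto simp: lookup_add)

lemma tensor_deg_add:
  assumes "self.subspace N" "x \<in> tensor_deg R N i b" "y \<in> tensor_deg R N i b"
  shows "x + y \<in> tensor_deg R N i b"
  using assms lookup_lookup_nonzero_add[of x y]
  by (auto simp: tensor_deg_iff lookup_add intro!: self.subspace_add) (blast | metis add_0)+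

lemma tensor_deg_diff:
  assumes "self.subspace N" "x \<in> tensor_deg R N i b" "y \<in> tensor_deg R N i b"
  shows "x - y \<in> tensor_deg R N i b"
  using assms unfolding tensor_deg_iff lookup_minus
  by (intro conjI) (auto intro!: self.subspace_diff, (metis diff_0_right diff_self)+)

lemma tensor_deg_mono: "N \<subseteq> N' \<Longrightarrow> x \<in> tensor_deg R N i b \<Longrightarrow> x \<in> tensor_deg R N' i b"
  by (auto simp: tensor_deg_iff)

text \<open>Splitting a polynomial, or a family of polynomials, by a condition on its monomials serves
  both to extract multigraded components and to decompose an element of a sum of two ideals.\<close>
definition restrict_coeffs :: "('a \<Rightarrow> bool) \<Rightarrow> ('a \<Rightarrow>\<^sub>0 'b::zero) \<Rightarrow> ('a \<Rightarrow>\<^sub>0 'b)" where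
  "restrict_coeffs P p = Poly_Mapping.mapp (\<lambda>m c. if P m then c else 0) p"

lemma lookup_restrict_coeffs:
  "Poly_Mapping.lookup (restrict_coeffs P p) m = (if P m then Poly_Mapping.lookup p m else 0)"
  by (auto simp: restrict_coeffs_def lookup_mapp when_def in_keys_iff)

definition restrict_family :: "('j \<Rightarrow> 'a \<Rightarrow> bool) \<Rightarrow> ('j \<Rightarrow>\<^sub>0 'a \<Rightarrow>\<^sub>0 'b::zero) \<Rightarrow> ('j \<Rightarrow>\<^sub>0 'a \<Rightarrow>\<^sub>0 'b)" where
  "restrict_family P x = Poly_Mapping.mapp (\<lambda>j. restrict_coeffs (P j)) x"

lemma lookup_restrict_family:
  "Poly_Mapping.lookup (Poly_Mapping.lookup (restrict_family P x) j) m =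
     (if P j m then Poly_Mapping.lookup (Poly_Mapping.lookup x j) m else 0)"
  by (auto simp: restrict_family_def lookup_mapp when_def in_keys_iff lookup_restrict_coeffs)

text \<open>
  The Tor module is computed from a resolution about which nothing is known beyond its
  defining properties. All vanishing statements are therefore proved for an arbitrary
  resolution of the residue field, using only its exactness, instead of comparing it with a
  particular one.
\<close>
locale residue_resolution =
  fixes R :: "('v::finite, 'k::field) graded_complex"
  assumes resolution: "is_residue_resolution R"
begin

lemma diff_hom: "module_hom smul smul (diff R i)"
  using resolution unfolding is_residue_resolution_def by (elim conjE) (erule spec)

lemmas diff_add = module_hom.add[OF diff_hom]
  and diff_sub = module_hom.diff[OF diff_hom]
  and diff_smul = module_hom.scale[OF diff_hom]
  and diff_sum = module_hom.sum[OF diff_hom]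
  and diff_zero = module_hom.zero[OF diff_hom]

lemma diff_tensor_deg_UNIV:
  "x \<in> tensor_deg R UNIV (Suc i) b \<Longrightarrow> diff R i x \<in> tensor_deg R UNIV i b"
  using resolution unfolding is_residue_resolution_def by (elim conjE) blast

lemma exact_0: "diff R 0 ` tensor R UNIV 1 = {x \<in> tensor R UNIV 0. augm R x = 0}"
  using resolution unfolding is_residue_resolution_def by (elim conjE)

lemma exact_Suc: "diff R (Suc i) ` tensor R UNIV (Suc (Suc i)) =
    {x \<in> tensor R UNIV (Suc i). diff R i x = 0}"
  using resolution unfolding is_residue_resolution_def by (elim conjE) (erule spec)

lemma augm_tensor_deg: "b \<noteq> 0 \<Longrightarrow> x \<in> tensor_deg R UNIV 0 b \<Longrightarrow> augm R x = 0"
  using resolution unfolding is_residue_resolution_def by (elim conjE) blast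

lemma diff_tensor_deg:
  assumes N: "self.subspace N" and x: "x \<in> tensor_deg R N (Suc i) b"
  shows "diff R i x \<in> tensor_deg R N i b"
proof -
  have "\<forall>j. Poly_Mapping.lookup (diff R i x) j \<in> N"
    using x by (intro linear_on_ideal[OF diff_hom N]) (simp add: tensor_deg_iff)
  moreover have "diff R i x \<in> tensor_deg R UNIV i b"
    using x by (intro diff_tensor_deg_UNIV) (simp add: tensor_deg_iff)
  ultimately show ?thesis
    by (simp add: tensor_deg_iff)
qed

text \<open>Exactness is a statement about whole modules; because the differential preserves
  multidegrees, a homogeneous boundary is the image of the matching component of any preimage.\<close>
lemma homogeneous_preimage:
  assumes w: "w \<in> tensor R UNIV (Suc i)" and dw: "diff R i w \<in> tensor_deg R UNIV i b"
  shows "diff R i w \<in> diff R i ` tensor_deg R UNIV (Suc i) b"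
proof -
  define part where "part c = restrict_family (\<lambda>j m. m + gdeg R (Suc i) j = c) w" for c
  \<comment> \<open>\<open>b\<close> is inserted since its component of \<open>w\<close> may vanish\<close>
  define degs where "degs = insert b ((\<lambda>(j, m). m + gdeg R (Suc i) j) `
    (SIGMA j:Poly_Mapping.keys w. Poly_Mapping.keys (Poly_Mapping.lookup w j)))"
  have fin: "finite degs"
    unfolding degs_def by auto
  have part: "part c \<in> tensor_deg R UNIV (Suc i) c" for c
    using w unfolding tensor_deg_iff tensor_iff part_def lookup_restrict_family
    by (metis UNIV_I lookup_zero)
  have w_eq: "w = (\<Sum>c\<in>degs. part c)"
  proof (intro poly_mapping_eqI)
    fix j m
    have "m + gdeg R (Suc i) j \<in> degs" if "Poly_Mapping.lookup (Poly_Mapping.lookup w j) m \<noteq> 0"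
      using that unfolding degs_def
      by (intro insertI2 image_eqI[of _ _ "(j, m)"]) (auto simp: in_keys_iff)
    then show "Poly_Mapping.lookup (Poly_Mapping.lookup w j) m =
        Poly_Mapping.lookup (Poly_Mapping.lookup (\<Sum>c\<in>degs. part c) j) m"
      using fin by (auto simp: lookup_sum part_def lookup_restrict_family)
  qed
  have "diff R i w = diff R i (part b)"
  proof (intro poly_mapping_eqI)
    fix j m
    have dpart: "m + gdeg R i j = c"
      if "Poly_Mapping.lookup (Poly_Mapping.lookup (diff R i (part c)) j) m \<noteq> 0" for c
      using diff_tensor_deg_UNIV[OF part] that by (simp add: tensor_deg_iff)
    have eq: "Poly_Mapping.lookup (Poly_Mapping.lookup (diff R i w) j) m =
        (\<Sum>c\<in>degs. Poly_Mapping.lookup (Poly_Mapping.lookup (diff R i (part c)) j) m)"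
      by (subst w_eq) (simp add: diff_sum lookup_sum)
    show "Poly_Mapping.lookup (Poly_Mapping.lookup (diff R i w) j) m =
        Poly_Mapping.lookup (Poly_Mapping.lookup (diff R i (part b)) j) m"
    proof (cases "m + gdeg R i j = b")
      case True
      then have "(\<Sum>c\<in>degs. Poly_Mapping.lookup (Poly_Mapping.lookup (diff R i (part c)) j) m) =
          (\<Sum>c\<in>{b}. Poly_Mapping.lookup (Poly_Mapping.lookup (diff R i (part c)) j) m)"
        using dpart fin by (intro sum.mono_neutral_right) (auto simp: degs_def)
      then show ?thesis
        using eq by simp
    next
      case False
      then have "Poly_Mapping.lookup (Poly_Mapping.lookup (diff R i w) j) m = 0"
        using dw by (auto simp: tensor_deg_iff)
      then show ?thesis
        using False dpart by metis
    qed
  qed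
  then show ?thesis
    using part by blast
qed

text \<open>The residue field lives in multidegree zero, so in any other multidegree the resolution is
  exact everywhere, including homological degree zero.\<close>
lemma cycles_UNIV:
  assumes "b \<noteq> 0"
  shows "cycles R UNIV i b \<subseteq> boundaries R UNIV i b"
proof
  fix z assume z: "z \<in> cycles R UNIV i b"
  then have deg: "z \<in> tensor_deg R UNIV i b"
    by (simp add: cycles_def)
  then have zt: "z \<in> tensor R UNIV i"
    by (simp add: tensor_deg_def)
  have "z \<in> diff R i ` tensor R UNIV (Suc i)"
  proof (cases i)
    case 0
    then show ?thesis
      using exact_0 augm_tensor_deg[OF assms] deg zt by auto
  next
    case (Suc j)
    then show ?thesis
      using exact_Suc[of j] zt z by (auto simp: cycles_def)
  qed
  then show "z \<in> boundaries R UNIV i b"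
    unfolding boundaries_def using homogeneous_preimage deg by auto
qed

text \<open>
  By Hochster's formula this property is the vanishing of the reduced simplicial homology of
  \<open>K\<close>. The lemmas that follow are the algebraic counterparts of the homology computations with
  simplices, cones and Mayer--Vietoris sequences; the empty simplicial complex counts as
  acyclic, whereas the complex whose only face is \<open>{}\<close> does not.
\<close>
definition tor_acyclic :: "'v set set \<Rightarrow> bool" where
  "tor_acyclic K \<longleftrightarrow> (\<forall>i. cycles R (complex_ideal K) i (squarefree_deg UNIV)
     \<subseteq> boundaries R (complex_ideal K) i (squarefree_deg UNIV))"

lemma tor_acyclic_empty: "tor_acyclic {}"
proof -
  have "z = 0" if "z \<in> cycles R (complex_ideal {}) i b" for z i b
    using that by (auto simp: cycles_def tensor_deg_iff complex_ideal_iff intro!: poly_mapping_eqI)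
  moreover have "0 \<in> boundaries R (complex_ideal {}) i b" for i b
    unfolding boundaries_def
    by (rule image_eqI[of _ _ 0]) (simp_all add: diff_zero tensor_deg_iff complex_ideal_iff)
  ultimately show ?thesis
    unfolding tor_acyclic_def by blast
qed

text \<open>For a simplex the ideal is principal, hence free of rank one, generated in the multidegree
  that marks the complement of \<open>\<sigma>\<close>. Dividing by the generator moves a cycle to the multidegree
  that marks \<open>\<sigma>\<close>, which is nonzero, and there the resolution is exact.\<close>
lemma tor_acyclic_Pow:
  assumes "\<sigma> \<noteq> {}"
  shows "tor_acyclic (Pow \<sigma>)"
  unfolding tor_acyclic_def
proof safe
  fix i z
  let ?N = "complex_ideal (Pow \<sigma>) :: ('v, 'k) mpoly set"
  let ?b = "squarefree_deg UNIV :: 'v expo"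
  let ?c = "squarefree_deg \<sigma>"
  define e :: "'v expo" where "e = squarefree_deg (- \<sigma>)"
  let ?x = "Poly_Mapping.single e (1 :: 'k)"
  assume z: "z \<in> cycles R ?N i ?b"
  have b: "?b = e + ?c"
    by (rule poly_mapping_eqI) (simp add: lookup_add lookup_squarefree_deg e_def)
  have c: "?c \<noteq> 0"
    using assms by (metis all_not_in_conv lookup_squarefree_deg lookup_zero zero_neq_one)
  have inj: "inj (\<lambda>m. e + m)"
    by (auto intro: injI)
  \<comment> \<open>the quotient of \<open>z\<close> by the generator of the ideal\<close>
  define y where "y = Poly_Mapping.map (Poly_Mapping.map_key (\<lambda>m. e + m)) z"
  have y: "Poly_Mapping.lookup (Poly_Mapping.lookup y j) m =
      Poly_Mapping.lookup (Poly_Mapping.lookup z j) (e + m)" for j m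
    by (simp add: y_def Poly_Mapping.map.rep_eq when_def map_key.rep_eq[OF inj])
  have zdeg: "z \<in> tensor_deg R ?N i ?b"
    using z by (simp add: cycles_def)
  have z_eq: "z = smul ?x y"
  proof (intro poly_mapping_eqI)
    fix j m
    show "Poly_Mapping.lookup (Poly_Mapping.lookup z j) m =
        Poly_Mapping.lookup (Poly_Mapping.lookup (smul ?x y) j) m"
    proof (cases "\<exists>k. m = e + k")
      case True
      then show ?thesis
        by (auto simp: lookup_single_mult_add y)
    next
      case False
      have "Poly_Mapping.lookup (Poly_Mapping.lookup z j) m = 0"
      proof (rule ccontr)
        assume "Poly_Mapping.lookup (Poly_Mapping.lookup z j) m \<noteq> 0"
        then have "zeros m \<subseteq> \<sigma>"
          using zdeg by (auto simp: tensor_deg_iff complex_ideal_iff)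
        then have "Poly_Mapping.lookup e v \<le> Poly_Mapping.lookup m v" for v
          by (auto simp: e_def lookup_squarefree_deg zeros_def Suc_le_eq)
        then show False
          using False expo_split by blast
      qed
      then show ?thesis
        using False by (simp add: lookup_single_mult_eq_0)
    qed
  qed
  have x_inj: "smul ?x u = 0 \<Longrightarrow> u = 0" for u :: "nat \<Rightarrow>\<^sub>0 ('v, 'k) mpoly"
    by (metis (no_types, lifting) lookup_single_mult_add lookup_smul lookup_zero mult_1 poly_mapping_eqI)
  have "y \<in> tensor_deg R UNIV i ?c"
    using zdeg by (simp add: tensor_deg_iff y b) (metis add.assoc add_left_imp_eq)
  moreover have "diff R j y = 0" if "i = Suc j" for j
  proof (rule x_inj)
    have "smul ?x (diff R j y) = diff R j z"
      by (simp only: diff_smul z_eq)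
    then show "smul ?x (diff R j y) = 0"
      using z that by (simp add: cycles_def)
  qed
  ultimately have "y \<in> cycles R UNIV i ?c"
    by (auto simp: cycles_def split: nat.split)
  then obtain w where w: "w \<in> tensor_deg R UNIV (Suc i) ?c" "y = diff R i w"
    using cycles_UNIV[OF c] by (auto simp: boundaries_def)
  have "zeros (e + k) \<subseteq> \<sigma>" for k
    by (auto simp: zeros_add) (auto simp: zeros_def e_def lookup_squarefree_deg split: if_splits)
  moreover have "\<exists>k. m = e + k \<and> Poly_Mapping.lookup (Poly_Mapping.lookup w j) k \<noteq> 0"
    if "Poly_Mapping.lookup (?x * Poly_Mapping.lookup w j) m \<noteq> 0" for j m
    using that by (metis lookup_single_mult_add lookup_single_mult_eq_0 mult_1)
  ultimately have "smul ?x w \<in> tensor_deg R ?N (Suc i) ?b"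
    using w(1) unfolding tensor_deg_iff complex_ideal_iff lookup_smul b
    by (fastforce simp: add.assoc)
  then show "z \<in> boundaries R ?N i ?b"
    unfolding boundaries_def z_eq w(2) diff_smul[symmetric] by (rule imageI)
qed

text \<open>
  Mayer--Vietoris. A cycle over the sum of the two ideals splits as \<open>x + y\<close>; the differential
  of \<open>x\<close> is then a cycle over the intersection, hence a boundary there, and subtracting a
  preimage makes both parts cycles.
\<close>
lemma tor_acyclic_Un:
  assumes down: "down_closed A" "down_closed B"
    and acyclic: "tor_acyclic A" "tor_acyclic B" "tor_acyclic (A \<inter> B)"
  shows "tor_acyclic (A \<union> B)"
  unfolding tor_acyclic_def
proof safe
  fix i z
  let ?N = "complex_ideal :: _ \<Rightarrow> ('v, 'k) mpoly set"
  let ?b = "squarefree_deg UNIV :: 'v expo"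
  note sub [intro] = subspace_complex_ideal[OF down(1)] subspace_complex_ideal[OF down(2)]
    subspace_complex_ideal[OF down_closed_Int[OF down]]
    subspace_complex_ideal[OF down_closed_Un[OF down]]
  have mono: "?N A \<subseteq> ?N (A \<union> B)" "?N B \<subseteq> ?N (A \<union> B)" "?N (A \<inter> B) \<subseteq> ?N A" "?N (A \<inter> B) \<subseteq> ?N B"
    by (auto simp: complex_ideal_iff)
  assume z: "z \<in> cycles R (?N (A \<union> B)) i ?b"
  \<comment> \<open>monomials whose zero set lies in both complexes go to \<open>x\<close>\<close>
  define x where "x = restrict_family (\<lambda>_ m. zeros m \<in> A) z"
  define y where "y = z - x"
  have x: "x \<in> tensor_deg R (?N A) i ?b" and y: "y \<in> tensor_deg R (?N B) i ?b"
    using z by (auto simp: cycles_def tensor_deg_iff complex_ideal_iff x_def y_def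
        lookup_restrict_family lookup_minus split: if_splits)
  have z_eq: "z = x + y"
    by (simp add: y_def)
  have "\<exists>w \<in> tensor_deg R (?N (A \<inter> B)) i ?b. x - w \<in> cycles R (?N A) i ?b \<and> y + w \<in> cycles R (?N B) i ?b"
  proof (cases i)
    case 0
    then show ?thesis
      using x y by (intro bexI[of _ 0]) (auto simp: cycles_def tensor_deg_iff complex_ideal_iff)
  next
    case (Suc j)
    have dz: "diff R j x = - diff R j y"
      using z unfolding z_eq by (simp add: cycles_def Suc diff_add add_eq_0_iff2)
    have dx: "diff R j x \<in> tensor_deg R (?N A) j ?b"
      using x Suc by (intro diff_tensor_deg) auto
    have dy: "diff R j y \<in> tensor_deg R (?N B) j ?b"
      using y Suc by (intro diff_tensor_deg) auto
    have "diff R j x \<in> tensor_deg R (?N (A \<inter> B)) j ?b"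
      using dx dy unfolding tensor_deg_iff complex_ideal_iff by (auto simp: dz)
    moreover have "diff R k (diff R j x) = 0" if "j = Suc k" for k
      using exact_Suc[of k] x Suc that by (auto simp: tensor_deg_def tensor_def)
    ultimately have "diff R j x \<in> cycles R (?N (A \<inter> B)) j ?b"
      by (auto simp: cycles_def split: nat.split)
    then obtain w where w: "w \<in> tensor_deg R (?N (A \<inter> B)) i ?b" "diff R j x = diff R j w"
      using acyclic(3) Suc unfolding tor_acyclic_def boundaries_def by blast
    have "x - w \<in> cycles R (?N A) i ?b"
      using x w(2) tensor_deg_mono[OF mono(3) w(1)] Suc
      by (auto simp: cycles_def diff_sub intro!: tensor_deg_diff)
    moreover have "y + w \<in> cycles R (?N B) i ?b"
      using y w(2) tensor_deg_mono[OF mono(4) w(1)] Suc dz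
      by (auto simp: cycles_def diff_add intro!: tensor_deg_add) (metis add.right_inverse)
    ultimately show ?thesis
      using w(1) by blast
  qed
  then obtain w u v where uv: "x - w = diff R i u" "u \<in> tensor_deg R (?N A) (Suc i) ?b"
      "y + w = diff R i v" "v \<in> tensor_deg R (?N B) (Suc i) ?b"
    using acyclic(1,2) unfolding tor_acyclic_def boundaries_def by blast
  have "z = (x - w) + (y + w)"
    by (simp add: z_eq)
  then have "z = diff R i (u + v)"
    by (simp only: uv diff_add)
  with uv show "z \<in> boundaries R (?N (A \<union> B)) i ?b"
    unfolding boundaries_def using tensor_deg_mono[OF mono(1)] tensor_deg_mono[OF mono(2)]
    by (auto intro!: image_eqI[of _ _ "u + v"] tensor_deg_add)
qed

text \<open>A complex all of whose facets contain \<open>v\<close> is a cone with apex \<open>v\<close>. Intersecting with a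
  further simplex \<open>\<tau>\<close> through \<open>v\<close> is what lets the induction on the number of facets run, because
  the overlap with one more facet is again of this form.\<close>
lemma tor_acyclic_common_vertex:
  assumes "finite F" "\<And>\<sigma>. \<sigma> \<in> F \<Longrightarrow> v \<in> \<sigma>"
  shows "tor_acyclic (\<Union>\<sigma>\<in>F. Pow \<sigma>)"
proof -
  have "tor_acyclic ((\<Union>\<sigma>\<in>F. Pow \<sigma>) \<inter> Pow \<tau>)" if "v \<in> \<tau>" for \<tau>
    using assms that
  proof (induction F arbitrary: \<tau> rule: finite_induct)
    case empty
    then show ?case
      by (simp add: tor_acyclic_empty)
  next
    case (insert \<sigma> F)
    let ?K = "\<Union>\<rho>\<in>F. Pow \<rho>"
    have IH: "tor_acyclic (?K \<inter> Pow \<rho>)" if "v \<in> \<rho>" for \<rho>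
      by (rule insert.IH) (use insert.prems that in simp_all)
    have "tor_acyclic (?K \<inter> Pow \<tau>)" "tor_acyclic (?K \<inter> Pow (\<sigma> \<inter> \<tau>))"
      using insert.prems by (simp_all only: IH IntI insertI1)
    moreover have "?K \<inter> Pow \<tau> \<inter> Pow (\<sigma> \<inter> \<tau>) = ?K \<inter> Pow (\<sigma> \<inter> \<tau>)"
      by auto
    moreover have "tor_acyclic (Pow (\<sigma> \<inter> \<tau>))"
      using insert.prems by (intro tor_acyclic_Pow) auto
    ultimately have "tor_acyclic (?K \<inter> Pow \<tau> \<union> Pow (\<sigma> \<inter> \<tau>))"
      by (intro tor_acyclic_Un down_closed_Int down_closed_UN_Pow down_closed_Pow) simp_all
    moreover have "(\<Union>\<rho>\<in>insert \<sigma> F. Pow \<rho>) \<inter> Pow \<tau> = ?K \<inter> Pow \<tau> \<union> Pow (\<sigma> \<inter> \<tau>)"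
      by auto
    ultimately show ?case
      by simp
  qed
  from this[of UNIV] show ?thesis
    by simp
qed

end

section \<open>The Koszul complex\<close>

text \<open>
  Some resolution of the residue field has to exist, and the Koszul complex is one. Its basis
  elements are the sets of variables, encoded by \<^const>\<open>to_nat\<close> because the basis of a free
  module is a set of natural numbers; the encoding also orders the variables, which fixes the
  signs.
\<close>

abbreviation coef :: "(nat \<Rightarrow>\<^sub>0 'a::zero) \<Rightarrow> 'v::finite set \<Rightarrow> 'a" where
  "coef x T \<equiv> Poly_Mapping.lookup x (to_nat T)"

definition family :: "('v::finite set \<Rightarrow> 'a::comm_monoid_add) \<Rightarrow> (nat \<Rightarrow>\<^sub>0 'a)" where
  "family c = (\<Sum>T\<in>UNIV. Poly_Mapping.single (to_nat T) (c T))"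

lemma coef_family [simp]: "coef (family c) T = c T"
  by (simp add: family_def lookup_sum lookup_single when_def)

lemma lookup_family_outside:
  fixes c :: "'v::finite set \<Rightarrow> 'a::comm_monoid_add"
  shows "n \<notin> range (to_nat :: 'v set \<Rightarrow> nat) \<Longrightarrow> Poly_Mapping.lookup (family c) n = 0"
  by (auto simp: family_def lookup_sum lookup_single when_def intro!: sum.neutral)

lemma lookup_family_nonzero:
  fixes c :: "'v::finite set \<Rightarrow> 'a::comm_monoid_add"
  assumes "Poly_Mapping.lookup (family c) n \<noteq> 0"
  obtains T :: "'v set" where "n = to_nat T"
  using assms lookup_family_outside[of n c] by blast

lemma lookup_Var_mult:
  fixes p :: "('v, 'k::comm_semiring_1) mpoly"
  shows "Poly_Mapping.lookup (Var v * p) m =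
    (if Poly_Mapping.lookup m v = 0 then 0 else Poly_Mapping.lookup p (m - Poly_Mapping.single v 1))"
proof (cases "Poly_Mapping.lookup m v = 0")
  case True
  then have "m \<noteq> Poly_Mapping.single v 1 + k" for k
    by (metis add_eq_0_iff_both_eq_0 lookup_add lookup_single_eq zero_neq_one)
  then show ?thesis
    using True by (simp add: Var_def lookup_single_mult_eq_0)
next
  case False
  then have "Poly_Mapping.lookup (Poly_Mapping.single v (1::nat)) w \<le> Poly_Mapping.lookup m w" for w
    by (auto simp: lookup_single when_def)
  then obtain k where "m = Poly_Mapping.single v 1 + k"
    by (rule expo_split)
  then show ?thesis
    using False by (simp add: Var_def lookup_single_mult_add)
qed

definition koszul_sign :: "'v::finite \<Rightarrow> 'v set \<Rightarrow> 'a::comm_ring_1" where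
  "koszul_sign v S = (- 1) ^ card {w\<in>S. to_nat w < to_nat v}"

lemma koszul_sign_insert:
  assumes "u \<notin> S" "u \<noteq> v"
  shows "koszul_sign v (insert u S) =
    (if to_nat u < to_nat v then - koszul_sign v S else koszul_sign v S :: 'a::comm_ring_1)"
proof -
  have "{w \<in> insert u S. to_nat w < to_nat v} = (if to_nat u < to_nat v
      then insert u {w\<in>S. to_nat w < to_nat v} else {w\<in>S. to_nat w < to_nat v})"
    by auto
  then show ?thesis
    using assms by (simp add: koszul_sign_def)
qed

lemma lookup_koszul_sign_mult:
  fixes p :: "('v, 'k::comm_ring_1) mpoly"
  shows "Poly_Mapping.lookup (koszul_sign v S * p) m = koszul_sign v S * Poly_Mapping.lookup p m"
proof -
  have "Poly_Mapping.lookup ((- 1) ^ n * p) m = (- 1) ^ n * Poly_Mapping.lookup p m" for n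
    by (induction n) (simp_all add: mult.assoc)
  then show ?thesis
    by (simp add: koszul_sign_def)
qed

definition koszul_diff :: "(nat \<Rightarrow>\<^sub>0 ('v::finite, 'k::field) mpoly) \<Rightarrow> (nat \<Rightarrow>\<^sub>0 ('v, 'k) mpoly)"
  where "koszul_diff x =
    family (\<lambda>S :: 'v set. \<Sum>v\<in>- S. koszul_sign v S * Var v * coef x (insert v S))"

lemma lookup_coef_koszul_diff:
  fixes x :: "nat \<Rightarrow>\<^sub>0 ('v::finite, 'k::field) mpoly" and S :: "'v set"
  shows "Poly_Mapping.lookup (coef (koszul_diff x) S) m = (\<Sum>v\<in>- S.
    if Poly_Mapping.lookup m v = 0 then 0
    else koszul_sign v S * Poly_Mapping.lookup (coef x (insert v S)) (m - Poly_Mapping.single v 1))"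
  unfolding koszul_diff_def coef_family lookup_sum mult.assoc lookup_koszul_sign_mult lookup_Var_mult
  by (simp add: if_distrib cong: if_cong)

lemma family_eqI:
  assumes "\<And>T :: 'v::finite set. coef x T = coef y T"
    and "\<And>n. n \<notin> range (to_nat :: 'v set \<Rightarrow> nat) \<Longrightarrow>
      Poly_Mapping.lookup x n = Poly_Mapping.lookup y n"
  shows "x = y"
  using assms by (intro poly_mapping_eqI) (metis rangeE)

lemma koszul_diff_hom: "module_hom smul smul (koszul_diff :: _ \<Rightarrow> (nat \<Rightarrow>\<^sub>0 ('v::finite, 'k::field) mpoly))"
proof (unfold_locales)
  fix x y :: "nat \<Rightarrow>\<^sub>0 ('v, 'k) mpoly"
  show "koszul_diff (x + y) = koszul_diff x + koszul_diff y"
    by (rule family_eqI[where 'v = 'v])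
      (simp_all add: koszul_diff_def lookup_add lookup_family_outside distrib_left sum.distrib)
next
  fix r :: "('v, 'k) mpoly" and x :: "nat \<Rightarrow>\<^sub>0 ('v, 'k) mpoly"
  show "koszul_diff (smul r x) = smul r (koszul_diff x)"
    by (rule family_eqI[where 'v = 'v])
      (simp_all add: koszul_diff_def lookup_family_outside sum_distrib_left mult_ac)
qed

text \<open>The two orders in which a pair of variables can be added to \<open>S\<close> contribute opposite terms.
  Pairing them, and not merely noting that the sum equals its negative, covers characteristic
  two.\<close>
lemma koszul_diff_diff:
  fixes x :: "nat \<Rightarrow>\<^sub>0 ('v::finite, 'k::field) mpoly"
  shows "koszul_diff (koszul_diff x) = 0"
proof (rule family_eqI[where 'v = 'v])
  fix S :: "'v set"
  define t :: "'v \<times> 'v \<Rightarrow> ('v, 'k) mpoly" where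
    "t = (\<lambda>(v, w). koszul_sign v S * Var v *
      (koszul_sign w (insert v S) * Var w * coef x (insert w (insert v S))))"
  \<comment> \<open>the ordered pairs; the pairs in the opposite order are their images under \<open>prod.swap\<close>\<close>
  define P where "P = {(v, w). v \<notin> S \<and> w \<notin> S \<and> to_nat v < to_nat w}"
  have t_swap: "t (w, v) = - t (v, w)" if "(v, w) \<in> P" for v w
    using that less_irrefl[of "to_nat v"] koszul_sign_insert[of v S w, where 'a = "('v, 'k) mpoly"]
      koszul_sign_insert[of w S v, where 'a = "('v, 'k) mpoly"]
    unfolding P_def t_def by (cases "v = w") (simp_all add: insert_commute[of w v] mult_ac)
  have "coef (koszul_diff (koszul_diff x)) S =
      (\<Sum>v\<in>- S. \<Sum>w\<in>- insert v S. t (v, w))"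
    by (simp add: koszul_diff_def t_def sum_distrib_left)
  also have "\<dots> = sum t (Sigma (- S) (\<lambda>v. - insert v S))"
    by (subst sum.Sigma) simp_all
  also have "Sigma (- S) (\<lambda>v. - insert v S) = P \<union> prod.swap ` P"
  proof (intro set_eqI, clarify)
    fix v w :: 'v
    show "((v, w) \<in> Sigma (- S) (\<lambda>v. - insert v S)) = ((v, w) \<in> P \<union> prod.swap ` P)"
      by (auto simp: P_def image_iff prod.swap_def) (metis nat_neq_iff to_nat_split inj_to_nat injD)+
  qed
  also have "sum t (P \<union> prod.swap ` P) = sum t P + sum t (prod.swap ` P)"
    by (intro sum.union_disjoint) (auto simp: P_def)
  also have "sum t (prod.swap ` P) = - sum t P"
    by (subst sum.reindex) (auto simp: t_swap sum_negf[symmetric] intro!: sum.cong)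
  finally show "coef (koszul_diff (koszul_diff x)) S = coef 0 S"
    by simp
qed (simp add: koszul_diff_def lookup_family_outside)

definition first_in :: "'v::finite set \<Rightarrow> 'v \<Rightarrow> bool" where
  "first_in S v \<longleftrightarrow> v \<in> S \<and> (\<forall>w\<in>S. to_nat v \<le> to_nat w)"

lemma first_in_unique: "first_in S v \<Longrightarrow> first_in S w \<Longrightarrow> v = w"
  unfolding first_in_def by (metis antisym inj_to_nat injD)

lemma first_in_exists: "S \<noteq> {} \<Longrightarrow> \<exists>v. first_in S v"
  unfolding first_in_def using ex_has_least_nat[of "\<lambda>v. v \<in> S" _ to_nat] by blast

text \<open>
  The component of the Koszul complex in a multidegree \<open>b\<close> is the chain complex of the full
  simplex on the support of \<open>b\<close>, and coning over a vertex contracts it. The homotopy cones over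
  the least variable \<open>v\<close> of the support: it sends \<open>x\<^sup>m e\<^sub>T\<close> with \<open>v \<notin> T\<close> to the term with one
  factor \<open>x\<^sub>v\<close> removed from the monomial and \<open>v\<close> added to \<open>T\<close>, and kills the terms with \<open>v \<in> T\<close>. The choice
  of the least variable makes the sign of this term positive. In terms of coefficients at \<open>T\<close>
  and \<open>m\<close>, it is nonzero only if the least variable of \<open>T\<close> is least in the whole support.
\<close>
definition koszul_homotopy ::
  "(nat \<Rightarrow>\<^sub>0 ('v::finite, 'k::field) mpoly) \<Rightarrow> (nat \<Rightarrow>\<^sub>0 ('v, 'k) mpoly)"
  where "koszul_homotopy x = family (\<lambda>T :: 'v set. if T = {} then 0 else
    let v = (THE v. first_in T v) in
      restrict_coeffs (\<lambda>m. first_in (T \<union> {w. Poly_Mapping.lookup m w \<noteq> 0}) v)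
        (Poly_Mapping.map_key (\<lambda>m. m + Poly_Mapping.single v 1) (coef x (T - {v}))))"

lemma lookup_coef_koszul_homotopy:
  fixes x :: "nat \<Rightarrow>\<^sub>0 ('v::finite, 'k::field) mpoly" and T :: "'v set"
  assumes v: "first_in (T \<union> {w. Poly_Mapping.lookup m w \<noteq> 0}) v"
  shows "Poly_Mapping.lookup (coef (koszul_homotopy x) T) m =
    (if v \<in> T then Poly_Mapping.lookup (coef x (T - {v})) (m + Poly_Mapping.single v 1) else 0)"
proof (cases "T = {}")
  case False
  then obtain u where u: "first_in T u"
    using first_in_exists by blast
  then have the: "(THE v. first_in T v) = u"
    using first_in_unique by blast
  have inj: "inj (\<lambda>m :: 'v expo. m + Poly_Mapping.single u 1)"
    by (auto intro: injI)
  have "first_in (T \<union> {w. Poly_Mapping.lookup m w \<noteq> 0}) u \<longleftrightarrow> v \<in> T"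
  proof
    assume "first_in (T \<union> {w. Poly_Mapping.lookup m w \<noteq> 0}) u"
    then show "v \<in> T"
      using u v first_in_unique unfolding first_in_def by metis
  next
    assume "v \<in> T"
    then have "first_in T v"
      using v by (auto simp: first_in_def)
    then show "first_in (T \<union> {w. Poly_Mapping.lookup m w \<noteq> 0}) u"
      using u v first_in_unique by blast
  qed
  moreover have "u = v" if "v \<in> T"
    using that u v by (intro first_in_unique[OF u]) (auto simp: first_in_def)
  moreover have "Poly_Mapping.lookup (coef (koszul_homotopy x) T) m =
      (if first_in (T \<union> {w. Poly_Mapping.lookup m w \<noteq> 0}) u
       then Poly_Mapping.lookup (coef x (T - {u})) (m + Poly_Mapping.single u 1) else 0)"
    using False by (simp add: koszul_homotopy_def the lookup_restrict_coeffs map_key.rep_eq[OF inj]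
        del: One_nat_def)
  ultimately show ?thesis
    by auto
qed (simp add: koszul_homotopy_def)

lemma coef_koszul_homotopy_nonzero:
  fixes x :: "nat \<Rightarrow>\<^sub>0 ('v::finite, 'k::field) mpoly" and T :: "'v set"
  assumes "coef (koszul_homotopy x) T \<noteq> 0"
  obtains v where "v \<in> T" "coef x (T - {v}) \<noteq> 0"
proof -
  obtain m where m: "Poly_Mapping.lookup (coef (koszul_homotopy x) T) m \<noteq> 0"
    using assms by (metis lookup_zero poly_mapping_eqI)
  have "T \<noteq> {}"
    using assms by (auto simp: koszul_homotopy_def)
  then obtain v where "first_in (T \<union> {w. Poly_Mapping.lookup m w \<noteq> 0}) v"
    using first_in_exists[of "T \<union> {w. Poly_Mapping.lookup m w \<noteq> 0}"] by blast
  then show ?thesis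
    using m that[of v] by (cases "coef x (T - {v}) = 0") (auto simp: lookup_coef_koszul_homotopy split: if_splits)
qed

text \<open>
  Let \<open>v\<close> be the least variable of the support of the multidegree. If \<open>v \<notin> T\<close>, only the term of
  the differential that adds \<open>v\<close> survives the homotopy. If \<open>v \<in> T\<close>, that term arises in the
  other composite, and the remaining terms of the two composites cancel, since adding \<open>w\<close> to \<open>T\<close>
  and to \<open>T - {v}\<close> carries opposite signs.
\<close>
lemma koszul_homotopy_identity:
  fixes x :: "nat \<Rightarrow>\<^sub>0 ('v::finite, 'k::field) mpoly" and T :: "'v set"
  assumes "T \<noteq> {} \<or> m \<noteq> 0"
  shows "Poly_Mapping.lookup (coef (koszul_diff (koszul_homotopy x)) T) m +
    Poly_Mapping.lookup (coef (koszul_homotopy (koszul_diff x)) T) m =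
    Poly_Mapping.lookup (coef x T) m"
proof -
  let ?e = "\<lambda>v. Poly_Mapping.single v (1::nat)"
  let ?supp = "\<lambda>T m. T \<union> {w. Poly_Mapping.lookup m w \<noteq> 0}"
  have "?supp T m \<noteq> {}"
    using assms by (auto intro!: poly_mapping_eqI)
  then obtain v where v: "first_in (?supp T m) v"
    using first_in_exists[of "?supp T m"] by blast
  have supp: "?supp (insert w T) (m - ?e w) = ?supp T m" if "Poly_Mapping.lookup m w \<noteq> 0" for w
    using that by (auto simp: lookup_minus lookup_single when_def split: if_splits)
  have sign_v: "koszul_sign v (T - {v}) = (1 :: 'k)"
  proof -
    have none: "{w \<in> T - {v}. to_nat w < to_nat v} = {}"
      using v by (force simp: first_in_def)
    show ?thesis
      unfolding koszul_sign_def none by simp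
  qed
  have hw: "Poly_Mapping.lookup (coef (koszul_homotopy x) (insert w T)) (m - ?e w) =
      (if v \<in> insert w T
       then Poly_Mapping.lookup (coef x (insert w T - {v})) (m - ?e w + ?e v) else 0)"
    if "Poly_Mapping.lookup m w \<noteq> 0" for w
    by (rule lookup_coef_koszul_homotopy) (simp only: supp[OF that] v)
  have dh: "Poly_Mapping.lookup (coef (koszul_diff (koszul_homotopy x)) T) m =
      (\<Sum>w\<in>- T. if Poly_Mapping.lookup m w = 0 then 0 else koszul_sign w T *
        (if v \<in> insert w T
         then Poly_Mapping.lookup (coef x (insert w T - {v})) (m - ?e w + ?e v) else 0))"
    unfolding lookup_coef_koszul_diff
    by (intro sum.cong refl if_cong) (simp only: hw not_False_eq_True)
  show ?thesis
  proof (cases "v \<in> T")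
    case False
    then have mv: "Poly_Mapping.lookup m v \<noteq> 0"
      using v by (auto simp: first_in_def)
    then have "m - ?e v + ?e v = m"
      by (intro poly_mapping_eqI) (auto simp: lookup_add lookup_minus lookup_single when_def)
    then have "Poly_Mapping.lookup (coef (koszul_diff (koszul_homotopy x)) T) m =
        (\<Sum>w\<in>- T. if w = v then Poly_Mapping.lookup (coef x T) m else 0)"
      unfolding dh using False mv sign_v by (intro sum.cong) auto
    then show ?thesis
      using False by (simp add: lookup_coef_koszul_homotopy[OF v])
  next
    case True
    have compl: "- (T - {v}) = insert v (- T)"
      using True by auto
    have opposite: "(if Poly_Mapping.lookup m w = 0 then 0 else koszul_sign w T *
        Poly_Mapping.lookup (coef x (insert w T - {v})) (m - ?e w + ?e v)) =
      - (if Poly_Mapping.lookup (m + ?e v) w = 0 then 0 else koszul_sign w (T - {v}) *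
        Poly_Mapping.lookup (coef x (insert w (T - {v}))) (m + ?e v - ?e w))"
      if "w \<in> - T" for w
    proof (cases "Poly_Mapping.lookup m w = 0")
      case True
      then show ?thesis
        using that \<open>v \<in> T\<close> by (auto simp: lookup_add lookup_single when_def)
    next
      case False
      have "m - ?e w + ?e v = m + ?e v - ?e w"
        using False by (intro poly_mapping_eqI) (auto simp: lookup_add lookup_minus lookup_single when_def)
      moreover have "insert w T - {v} = insert w (T - {v})"
        using that \<open>v \<in> T\<close> by auto
      moreover have "to_nat v < to_nat w"
        using v that \<open>v \<in> T\<close> False unfolding first_in_def
        by (metis (mono_tags, lifting) ComplD UnCI inj_to_nat injD le_neq_implies_less mem_Collect_eq)
      then have "koszul_sign w T = - (koszul_sign w (T - {v}) :: 'k)"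
        using koszul_sign_insert[of v "T - {v}" w, where 'a = 'k] \<open>v \<in> T\<close>
        by (auto simp: insert_absorb)
      ultimately show ?thesis
        using False by (simp add: lookup_add)
    qed
    have "Poly_Mapping.lookup (coef (koszul_homotopy (koszul_diff x)) T) m =
        Poly_Mapping.lookup (coef (koszul_diff x) (T - {v})) (m + ?e v)"
      using True by (simp add: lookup_coef_koszul_homotopy[OF v])
    also have "\<dots> = Poly_Mapping.lookup (coef x T) m +
      (\<Sum>w\<in>- T. if Poly_Mapping.lookup (m + ?e v) w = 0 then 0 else koszul_sign w (T - {v}) *
        Poly_Mapping.lookup (coef x (insert w (T - {v}))) (m + ?e v - ?e w))"
      unfolding lookup_coef_koszul_diff compl using True sign_v
      by (subst sum.insert) (auto simp: lookup_add insert_absorb)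
    finally have hd: "Poly_Mapping.lookup (coef (koszul_homotopy (koszul_diff x)) T) m = \<dots>" .
    have "Poly_Mapping.lookup (coef (koszul_diff (koszul_homotopy x)) T) m =
      - (\<Sum>w\<in>- T. if Poly_Mapping.lookup (m + ?e v) w = 0 then 0 else koszul_sign w (T - {v}) *
        Poly_Mapping.lookup (coef x (insert w (T - {v}))) (m + ?e v - ?e w))"
      unfolding dh sum_negf[symmetric]
      by (intro sum.cong refl) (simp only: opposite[symmetric] True insertI2 if_True)
    then show ?thesis
      unfolding hd by simp
  qed
qed

definition koszul_complex :: "('v::finite, 'k::field) graded_complex" where
  "koszul_complex = \<lparr>gens = \<lambda>i. to_nat ` {T :: 'v set. card T = i},
     gdeg = \<lambda>_ j. squarefree_deg (from_nat j),
     diff = \<lambda>_. koszul_diff,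
     augm = \<lambda>x. Poly_Mapping.lookup (coef x ({} :: 'v set)) 0\<rparr>"

text \<open>The homotopy identity fails only at the empty set and the constant monomial, that is, for
  the coefficient that the augmentation reads off.\<close>
lemma koszul_diff_eq_homotopy:
  fixes x :: "nat \<Rightarrow>\<^sub>0 ('v::finite, 'k::field) mpoly"
  assumes "x \<in> tensor koszul_complex UNIV i" "koszul_diff x = 0"
    and "Poly_Mapping.lookup (coef x ({} :: 'v set)) 0 = 0"
  shows "x \<in> koszul_diff ` tensor koszul_complex UNIV (Suc i)"
proof (rule image_eqI)
  let ?h = "koszul_homotopy :: _ \<Rightarrow> (nat \<Rightarrow>\<^sub>0 ('v, 'k) mpoly)"
  have supp: "\<exists>T :: 'v set. n = to_nat T \<and> card T = i" if "Poly_Mapping.lookup x n \<noteq> 0" for n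
    using assms(1) that by (auto simp: tensor_iff koszul_complex_def)
  show "x = koszul_diff (?h x)"
  proof (rule family_eqI[where 'v = 'v])
    fix T :: "'v set"
    have h0: "coef (?h 0) T = 0"
      by (rule ccontr) (auto elim: coef_koszul_homotopy_nonzero)
    show "coef x T = coef (koszul_diff (?h x)) T"
    proof (rule poly_mapping_eqI)
      fix m
      show "Poly_Mapping.lookup (coef x T) m =
          Poly_Mapping.lookup (coef (koszul_diff (?h x)) T) m"
      proof (cases "T \<noteq> {} \<or> m \<noteq> 0")
        case True
        then show ?thesis
          using koszul_homotopy_identity[OF True, of x] by (simp add: assms(2) h0)
      next
        case False
        then show ?thesis
          using assms(3) by (simp add: lookup_coef_koszul_diff)
      qed
    qed
  next
    fix n assume "n \<notin> range (to_nat :: 'v set \<Rightarrow> nat)"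
    moreover from this have "Poly_Mapping.lookup x n = 0"
      using supp by - (rule ccontr, blast)
    ultimately show "Poly_Mapping.lookup x n = Poly_Mapping.lookup (koszul_diff (?h x)) n"
      by (simp add: koszul_diff_def lookup_family_outside)
  qed
  have "\<exists>T :: 'v set. n = to_nat T \<and> card T = Suc i" if nz: "Poly_Mapping.lookup (?h x) n \<noteq> 0" for n
  proof -
    obtain T :: "'v set" where T: "n = to_nat T"
      using nz unfolding koszul_homotopy_def by (rule lookup_family_nonzero)
    have "coef (?h x) T \<noteq> 0"
      using nz by (simp add: T)
    then obtain v where v: "v \<in> T" "coef x (T - {v}) \<noteq> 0"
      by (rule coef_koszul_homotopy_nonzero)
    then have "card (T - {v}) = i"
      using supp by fastforce
    then show ?thesis
      using T v(1) by (metis card.remove finite)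
  qed
  then show "?h x \<in> tensor koszul_complex UNIV (Suc i)"
    by (auto simp: tensor_iff koszul_complex_def)
qed

lemma koszul_diff_tensor_deg:
  fixes x :: "nat \<Rightarrow>\<^sub>0 ('v::finite, 'k::field) mpoly"
  assumes x: "x \<in> tensor_deg koszul_complex UNIV (Suc i) b"
  shows "koszul_diff x \<in> tensor_deg koszul_complex UNIV i b"
proof -
  have "j \<in> to_nat ` {T :: 'v set. card T = i} \<and> m + squarefree_deg (from_nat j :: 'v set) = b"
    if nz: "Poly_Mapping.lookup (Poly_Mapping.lookup (koszul_diff x) j) m \<noteq> 0" for j m
  proof -
    have "Poly_Mapping.lookup (koszul_diff x) j \<noteq> 0"
      using nz by auto
    then obtain S :: "'v set" where S: "j = to_nat S"
      unfolding koszul_diff_def by (rule lookup_family_nonzero)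
    have "(\<Sum>v\<in>- S. if Poly_Mapping.lookup m v = 0 then 0 else koszul_sign v S *
        Poly_Mapping.lookup (coef x (insert v S)) (m - Poly_Mapping.single v 1)) \<noteq> 0"
      using nz unfolding S lookup_coef_koszul_diff .
    then obtain v where "v \<in> - S" "(if Poly_Mapping.lookup m v = 0 then 0 else koszul_sign v S *
        Poly_Mapping.lookup (coef x (insert v S)) (m - Poly_Mapping.single v 1)) \<noteq> 0"
      by (rule sum.not_neutral_contains_not_neutral)
    then have v: "v \<notin> S" "Poly_Mapping.lookup m v \<noteq> 0"
        "Poly_Mapping.lookup (coef x (insert v S)) (m - Poly_Mapping.single v 1) \<noteq> 0"
      by (auto split: if_splits)
    have "to_nat (insert v S) \<in> gens (koszul_complex :: ('v, 'k) graded_complex) (Suc i) \<and>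
        m - Poly_Mapping.single v 1 +
        gdeg (koszul_complex :: ('v, 'k) graded_complex) (Suc i) (to_nat (insert v S)) = b"
      using x v(3) unfolding tensor_deg_iff by blast
    then have deg: "m - Poly_Mapping.single v 1 + squarefree_deg (insert v S) = b" and "card S = i"
      using v(1) by (auto simp: koszul_complex_def)
    moreover have "m - Poly_Mapping.single v 1 + squarefree_deg (insert v S) = m + squarefree_deg S"
      using v(1,2) by (intro poly_mapping_eqI)
        (auto simp: lookup_add lookup_minus lookup_single when_def lookup_squarefree_deg)
    ultimately show ?thesis
      using S deg by simp
  qed
  then show ?thesis
    by (simp add: tensor_deg_iff koszul_complex_def)
qed

lemma koszul_resolution:
  "is_residue_resolution (koszul_complex :: ('v::finite, 'k::field) graded_complex)"
proof -
  let ?K = "koszul_complex :: ('v, 'k) graded_complex"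
  have fields: "gens ?K i = to_nat ` {T :: 'v set. card T = i}" "diff ?K i = koszul_diff"
      "augm ?K = (\<lambda>x. Poly_Mapping.lookup (coef x ({} :: 'v set)) 0)" for i
    by (simp_all add: koszul_complex_def)
  have lookup_0: "Poly_Mapping.lookup (p * q) 0 = Poly_Mapping.lookup p 0 * Poly_Mapping.lookup q 0"
    for p q :: "('v, 'k) mpoly"
  proof -
    have "(0 :: 'v expo) = l + k \<longleftrightarrow> l = 0 \<and> k = 0" for l k
      by (auto simp: poly_mapping_eq_iff fun_eq_iff lookup_add)
    then have "(\<Sum>k. Poly_Mapping.lookup q k when 0 = l + k) = (Poly_Mapping.lookup q 0 when l = 0)" for l
      by (cases "l = 0") simp_all
    then show ?thesis
      by (simp add: lookup_mult mult_when)
  qed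
  have augm_hom: "module_hom smul residue_scale (augm ?K)"
    by unfold_locales (simp_all add: fields residue_scale_def lookup_add lookup_0 distrib_left distrib_right)
  have surj: "augm ?K ` tensor ?K UNIV 0 = UNIV"
  proof (intro equalityI subset_UNIV subsetI)
    fix c :: 'k
    have "c = augm ?K (Poly_Mapping.single (to_nat ({} :: 'v set)) (Poly_Mapping.single 0 c))"
      by (simp add: fields)
    moreover have "Poly_Mapping.single (to_nat ({} :: 'v set)) (Poly_Mapping.single 0 c) \<in> tensor ?K UNIV 0"
      by (auto simp: tensor_iff fields lookup_single when_def)
    ultimately show "c \<in> augm ?K ` tensor ?K UNIV 0"
      by blast
  qed
  have coef_0: "coef x S = 0" if "x \<in> tensor ?K UNIV i" "card S \<noteq> i" for x i and S :: "'v set"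
    using that by (auto simp: tensor_iff fields)
  have diff_tensor: "koszul_diff x \<in> tensor ?K UNIV i" if "x \<in> tensor ?K UNIV (Suc i)" for x i
  proof -
    have "n \<in> to_nat ` {T :: 'v set. card T = i}"
      if nz: "Poly_Mapping.lookup (koszul_diff x) n \<noteq> 0" for n
    proof -
      obtain S :: "'v set" where S: "n = to_nat S"
        using nz unfolding koszul_diff_def by (rule lookup_family_nonzero)
      have "\<exists>v\<in>- S. coef x (insert v S) \<noteq> 0"
        using nz unfolding S koszul_diff_def coef_family
        by (metis (mono_tags, lifting) mult_zero_right sum.neutral)
      then obtain v where "v \<notin> S" "coef x (insert v S) \<noteq> 0"
        by blast
      then have "card S = i"
        using coef_0[OF \<open>x \<in> tensor ?K UNIV (Suc i)\<close>, of "insert v S"] by auto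
      then show ?thesis
        using S by blast
    qed
    then show ?thesis
      by (simp add: tensor_iff fields)
  qed
  have "koszul_diff x = 0" if "x \<in> tensor ?K UNIV 0" for x
  proof -
    have "coef x (insert v S) = 0" for v and S :: "'v set"
      by (rule coef_0[OF that]) simp
    then show ?thesis
      by (intro family_eqI[where 'v = 'v]) (simp_all add: koszul_diff_def lookup_family_outside)
  qed
  then have exact_0: "diff ?K 0 ` tensor ?K UNIV 1 = {x \<in> tensor ?K UNIV 0. augm ?K x = 0}"
    using diff_tensor[of _ 0] koszul_diff_eq_homotopy[where 'v = 'v and i = 0]
    by (auto simp: fields lookup_coef_koszul_diff)
  have exact_Suc: "diff ?K (Suc i) ` tensor ?K UNIV (Suc (Suc i)) =
      {x \<in> tensor ?K UNIV (Suc i). diff ?K i x = 0}" for i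
  proof -
    have "x \<in> koszul_diff ` tensor ?K UNIV (Suc (Suc i))"
      if "x \<in> tensor ?K UNIV (Suc i)" "koszul_diff x = 0" for x
      using that coef_0[OF that(1), of "{}"] by (intro koszul_diff_eq_homotopy) simp_all
    then show ?thesis
      using diff_tensor[of _ "Suc i"] by (auto simp: fields koszul_diff_diff)
  qed
  show ?thesis
    unfolding is_residue_resolution_def
  proof (intro conjI allI impI exact_0 exact_Suc augm_hom surj)
    show "augm ?K ` tensor_deg ?K UNIV 0 b \<subseteq> {0}" if "b \<noteq> 0" for b
    proof safe
      fix x assume "x \<in> tensor_deg ?K UNIV 0 b"
      then have "Poly_Mapping.lookup (coef x ({} :: 'v set)) 0 \<noteq> 0 \<longrightarrow>
          0 + gdeg ?K 0 (to_nat ({} :: 'v set)) = b"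
        unfolding tensor_deg_iff by blast
      then show "augm ?K x = 0"
        using \<open>b \<noteq> 0\<close> by (auto simp: koszul_complex_def squarefree_deg_def)
    qed
    show "diff ?K i ` tensor_deg ?K UNIV (Suc i) b \<subseteq> tensor_deg ?K UNIV i b" for i b
      using koszul_diff_tensor_deg by (auto simp: fields)
  qed (simp_all add: fields koszul_diff_hom)
qed

lemma tor_dim_eq_0:
  fixes K :: "'v::finite set set"
  assumes down: "down_closed K"
    and acyclic: "\<And>R :: ('v, 'k::field) graded_complex.
      residue_resolution R \<Longrightarrow> residue_resolution.tor_acyclic R K"
  shows "tor_dim i (complex_ideal K :: ('v, 'k) mpoly set) (squarefree_deg UNIV) = 0"
proof -
  define R :: "('v, 'k) graded_complex" where "R = (SOME R. is_residue_resolution R)"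
  have R: "is_residue_resolution R"
    unfolding R_def using koszul_resolution by (rule someI)
  then interpret residue_resolution R
    by unfold_locales
  have "cycles R (complex_ideal K) i (squarefree_deg UNIV) =
      boundaries R (complex_ideal K) i (squarefree_deg UNIV)"
    using acyclic[OF residue_resolution_axioms] boundaries_subset_cycles[OF R subspace_complex_ideal[OF down]]
    unfolding tor_acyclic_def by blast
  then show ?thesis
    by (simp add: tor_dim_def R_def[symmetric])
qed

section \<open>Complexes of sign patterns on relatively open convex sets\<close>

text \<open>
  A convex set is relatively open if each of its segments can be prolonged a little beyond its
  end points. In this form the notion needs no affine hull or topology, and it passes both to
  open half-spaces and to hyperplane sections, which is exactly what the induction below uses.
  The factors \<open>c\<close> and \<open>s\<close> in the lemmas allow both sides of a hyperplane to be treated at once.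
\<close>

definition rel_open_convex :: "('v \<Rightarrow> real) set \<Rightarrow> bool" where
  "rel_open_convex C \<longleftrightarrow> (\<forall>x\<in>C. \<forall>y\<in>C. \<exists>\<delta>>0. \<forall>t. - \<delta> \<le> t \<and> t \<le> 1 \<longrightarrow>
     (\<lambda>v. (1 - t) * x v + t * y v) \<in> C)"

lemma rel_open_convexE:
  assumes "rel_open_convex C" "x \<in> C" "y \<in> C"
  obtains \<delta> where "\<delta> > 0" "\<And>t. - \<delta> \<le> t \<Longrightarrow> t \<le> 1 \<Longrightarrow> (\<lambda>v. (1 - t) * x v + t * y v) \<in> C"
  using assms unfolding rel_open_convex_def by blast

lemma small_perturbation_pos:
  fixes a b :: "'v \<Rightarrow> real"
  assumes "finite P" "\<And>v. v \<in> P \<Longrightarrow> a v > 0"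
  obtains \<eta> where "\<eta> > 0" "\<And>t v. \<bar>t\<bar> \<le> \<eta> \<Longrightarrow> v \<in> P \<Longrightarrow> a v + t * b v > 0"
proof -
  have "\<forall>\<^sub>F t in nhds 0. a v + t * b v > 0" if "v \<in> P" for v
  proof (rule order_tendstoD)
    show "((\<lambda>t. a v + t * b v) \<longlongrightarrow> a v + 0 * b v) (nhds 0)"
      by (intro tendsto_intros filterlim_ident)
  qed (simp add: assms(2) that)
  then have "\<forall>\<^sub>F t in nhds 0. \<forall>v\<in>P. a v + t * b v > 0"
    using assms(1) by (intro eventually_ball_finite) auto
  then obtain d where d: "d > 0" "\<And>t. \<bar>t\<bar> < d \<Longrightarrow> \<forall>v\<in>P. a v + t * b v > 0"
    unfolding eventually_nhds_metric by (auto simp: dist_real_def)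
  then show ?thesis
    by (intro that[of "d / 2"]) auto
qed

lemma rel_open_convex_open_half:
  assumes C: "rel_open_convex C"
  shows "rel_open_convex {x \<in> C. c * x u > 0}"
  unfolding rel_open_convex_def
proof safe
  fix x y assume x: "x \<in> C" "c * x u > 0" and y: "y \<in> C" "c * y u > 0"
  obtain \<delta> where \<delta>: "\<delta> > 0"
      "\<And>t. - \<delta> \<le> t \<Longrightarrow> t \<le> 1 \<Longrightarrow> (\<lambda>v. (1 - t) * x v + t * y v) \<in> C"
    using rel_open_convexE[OF C x(1) y(1)] by blast
  obtain \<eta> where \<eta>: "\<eta> > 0" "\<And>t v. \<bar>t\<bar> \<le> \<eta> \<Longrightarrow> v \<in> {u} \<Longrightarrow> c * x v + t * (c * (y v - x v)) > 0"
    using small_perturbation_pos[of "{u}" "\<lambda>v. c * x v" "\<lambda>v. c * (y v - x v)"] x(2) by auto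
  have "c * ((1 - t) * x u + t * y u) > 0" if "- min \<delta> \<eta> \<le> t" "t \<le> 1" for t
  proof -
    have eq: "c * ((1 - t) * x u + t * y u) = c * x u + t * (c * (y u - x u))"
        "c * ((1 - t) * x u + t * y u) = (1 - t) * (c * x u) + t * (c * y u)"
      by (simp_all add: algebra_simps)
    show ?thesis
    proof (cases "t \<le> 0")
      case True
      then show ?thesis
        unfolding eq(1) using that by (intro \<eta>(2)) auto
    next
      case False
      then have "0 \<le> (1 - t) * (c * x u)" "0 < t * (c * y u)"
        using x(2) y(2) that(2) by simp_all
      then show ?thesis
        unfolding eq(2) by linarith
    qed
  qed
  then show "\<exists>\<delta>>0. \<forall>t. - \<delta> \<le> t \<and> t \<le> 1 \<longrightarrow>
      (\<lambda>v. (1 - t) * x v + t * y v) \<in> {x \<in> C. c * x u > 0}"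
    using \<delta> \<eta>(1) by (intro exI[of _ "min \<delta> \<eta>"]) auto
qed

lemma rel_open_convex_hyperplane:
  assumes "rel_open_convex C"
  shows "rel_open_convex {x \<in> C. x u = 0}"
  unfolding rel_open_convex_def
proof safe
  fix x y assume x: "x \<in> C" "x u = 0" and y: "y \<in> C" "y u = 0"
  obtain \<delta> where "\<delta> > 0"
      "\<And>t. - \<delta> \<le> t \<Longrightarrow> t \<le> 1 \<Longrightarrow> (\<lambda>v. (1 - t) * x v + t * y v) \<in> C"
    using rel_open_convexE[OF assms x(1) y(1)] by blast
  then show "\<exists>\<delta>>0. \<forall>t. - \<delta> \<le> t \<and> t \<le> 1 \<longrightarrow>
      (\<lambda>v. (1 - t) * x v + t * y v) \<in> {x \<in> C. x u = 0}"
    using x(2) y(2) by (intro exI[of _ \<delta>]) simp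
qed

text \<open>A point on a hyperplane that does not contain \<open>C\<close> can be moved to either side of it by
  passing slightly along or against the direction of \<open>y\<close>, keeping finitely many strict
  inequalities.\<close>
lemma rel_open_convex_leave_hyperplane:
  assumes C: "rel_open_convex C" and "finite P"
    and x: "x \<in> C" "x u = 0" "\<And>v. v \<in> P \<Longrightarrow> x v > 0" and y: "y \<in> C" "y u \<noteq> 0"
    and s: "s \<noteq> 0"
  obtains z where "z \<in> C" "s * z u > 0" "\<And>v. v \<in> P \<Longrightarrow> z v > 0"
proof -
  obtain \<delta> where \<delta>: "\<delta> > 0"
      "\<And>t. - \<delta> \<le> t \<Longrightarrow> t \<le> 1 \<Longrightarrow> (\<lambda>v. (1 - t) * x v + t * y v) \<in> C"
    using rel_open_convexE[OF C x(1) y(1)] by blast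
  obtain \<eta> where \<eta>: "\<eta> > 0" "\<And>t v. \<bar>t\<bar> \<le> \<eta> \<Longrightarrow> v \<in> P \<Longrightarrow> x v + t * (y v - x v) > 0"
    using small_perturbation_pos[of P x "\<lambda>v. y v - x v"] assms(2) x(3) by blast
  define m where "m = min (min \<delta> 1) \<eta>"
  define t where "t = sgn (s * y u) * m"
  have "m > 0" "\<bar>t\<bar> = m"
    using \<delta>(1) \<eta>(1) s y(2) by (auto simp: m_def t_def abs_mult abs_sgn_eq)
  then have t: "- \<delta> \<le> t" "t \<le> 1" "\<bar>t\<bar> \<le> \<eta>"
    by (auto simp: m_def)
  have "s * (t * y u) = \<bar>s * y u\<bar> * m"
    by (simp add: t_def abs_sgn mult_ac)
  then have "s * (t * y u) > 0"
    using \<open>m > 0\<close> s y(2) by simp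
  moreover have "(1 - t) * x v + t * y v > 0" if "v \<in> P" for v
    using \<eta>(2)[OF t(3) that] by (simp add: algebra_simps)
  ultimately show ?thesis
    using x(2) by (intro that[OF \<delta>(2)[OF t(1,2)]]) simp_all
qed

text \<open>This is the nerve of the family of open half-spaces \<open>{x \<in> C. x v > 0}\<close>, \<open>v \<in> A\<close>.\<close>
definition pos_complex :: "('v \<Rightarrow> real) set \<Rightarrow> 'v set \<Rightarrow> 'v set set" where
  "pos_complex C A = {P. P \<subseteq> A \<and> (\<exists>x\<in>C. \<forall>v\<in>P. x v > 0)}"

lemma down_closed_pos_complex: "down_closed (pos_complex C A)"
  by (auto simp: down_closed_def pos_complex_def)

text \<open>The union describes the cone over \<open>K\<close> with apex \<open>u\<close>.\<close>
lemma in_star_iff: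
  assumes "down_closed K"
  shows "P \<in> (\<Union>\<sigma>\<in>insert u ` K. Pow \<sigma>) \<longleftrightarrow> P - {u} \<in> K"
proof
  assume "P \<in> (\<Union>\<sigma>\<in>insert u ` K. Pow \<sigma>)"
  then obtain \<sigma> where "\<sigma> \<in> K" "P - {u} \<subseteq> \<sigma>"
    by blast
  then show "P - {u} \<in> K"
    using assms by (auto simp: down_closed_def)
qed blast

text \<open>
  Adding the half-space of \<open>u\<close> to the nerve. A pattern on \<open>A\<close> is realised off the hyperplane of
  \<open>u\<close> whenever it is realised on it; a pattern realised on both sides is realised on the
  hyperplane, by convexity.
\<close>
lemma pos_complex_insert:
  fixes A :: "'v::finite set"
  assumes C: "rel_open_convex C" and u: "u \<notin> A" and y: "y \<in> C" "y u > 0"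
  defines "star \<equiv> \<Union>\<sigma>\<in>insert u ` pos_complex {x \<in> C. x u > 0} A. Pow \<sigma>"
  shows "pos_complex C (insert u A) = star \<union> pos_complex {x \<in> C. x u < 0} A" (is ?union)
    and "star \<inter> pos_complex {x \<in> C. x u < 0} A = pos_complex {x \<in> C. x u = 0} A" (is ?inter)
proof -
  have side: "P \<in> pos_complex {x \<in> C. x u > 0} A \<inter> pos_complex {x \<in> C. x u < 0} A"
    if P: "P \<subseteq> A" "x \<in> C" "x u = 0" "\<forall>v\<in>P. x v > 0" for P x
  proof -
    have "\<exists>z\<in>C. s * z u > 0 \<and> (\<forall>v\<in>P. z v > 0)" if "s \<noteq> 0" for s
      using rel_open_convex_leave_hyperplane[OF C finite P(2,3) _ y(1) _ that] P(4) y(2)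
      by (metis less_irrefl)
    from this[of 1] this[of "- 1"] show ?thesis
      using P(1) by (auto simp: pos_complex_def)
  qed
  show ?union
  proof (intro equalityI subsetI)
    fix P assume "P \<in> pos_complex C (insert u A)"
    then obtain x where P: "P \<subseteq> insert u A" "x \<in> C" "\<forall>v\<in>P. x v > 0"
      by (auto simp: pos_complex_def)
    show "P \<in> star \<union> pos_complex {x \<in> C. x u < 0} A"
    proof (cases "x u < 0")
      case True
      then have "u \<notin> P"
        using P(3) by auto
      then show ?thesis
        using True P by (auto simp: pos_complex_def)
    next
      case False
      then have "P - {u} \<in> pos_complex {x \<in> C. x u > 0} A"
        using P side[of "P - {u}" x] by (cases "x u = 0") (auto simp: pos_complex_def)
      then show ?thesis
        unfolding star_def by blast
    qed
  qed (auto simp: star_def pos_complex_def)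
  show ?inter
  proof (intro equalityI subsetI)
    fix P assume P: "P \<in> star \<inter> pos_complex {x \<in> C. x u < 0} A"
    then have "P \<in> pos_complex {x \<in> C. x u > 0} A"
      using u in_star_iff[OF down_closed_pos_complex, of P u "{x \<in> C. x u > 0}" A]
      unfolding star_def by (auto simp: pos_complex_def insert_absorb)
    then obtain p where p: "p \<in> C" "p u > 0" "\<forall>v\<in>P. p v > 0"
      by (auto simp: pos_complex_def)
    obtain n where n: "n \<in> C" "n u < 0" "\<forall>v\<in>P. n v > 0" and "P \<subseteq> A"
      using P by (auto simp: pos_complex_def)
    \<comment> \<open>the point where the segment from \<open>p\<close> to \<open>n\<close> crosses the hyperplane\<close>
    define t where "t = p u / (p u - n u)"
    have t: "0 < t" "t < 1" and zero: "(1 - t) * p u + t * n u = 0"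
      using p(2) n(2) by (simp_all add: t_def field_simps)
    have "(\<lambda>v. (1 - t) * p v + t * n v) \<in> C"
      by (rule rel_open_convexE[OF C p(1) n(1)]) (use t in auto)
    moreover have "(1 - t) * p v + t * n v > 0" if "v \<in> P" for v
      using p(3) n(3) t that by (simp add: add_pos_pos)
    ultimately show "P \<in> pos_complex {x \<in> C. x u = 0} A"
      using zero \<open>P \<subseteq> A\<close> unfolding pos_complex_def mem_Collect_eq
      by (intro conjI bexI[of _ "\<lambda>v. (1 - t) * p v + t * n v"]) simp_all
  next
    fix P assume "P \<in> pos_complex {x \<in> C. x u = 0} A"
    then obtain x where "P \<subseteq> A" "x \<in> C" "x u = 0" "\<forall>v\<in>P. x v > 0"
      by (auto simp: pos_complex_def)
    then have "P \<in> pos_complex {x \<in> C. x u > 0} A \<inter> pos_complex {x \<in> C. x u < 0} A"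
      by (rule side)
    then show "P \<in> star \<inter> pos_complex {x \<in> C. x u < 0} A"
      unfolding star_def by blast
  qed
qed

context residue_resolution
begin

lemma tor_acyclic_star: "tor_acyclic (\<Union>\<tau>\<in>insert v ` K. Pow \<tau>)"
  by (rule tor_acyclic_common_vertex) auto

text \<open>
  A special case of the nerve theorem: a convex set covered by open half-spaces has an acyclic
  nerve. In the induction on \<open>A\<close>, a half-space \<open>u\<close> that meets \<open>C\<close> splits the nerve into a cone
  with apex \<open>u\<close> and the nerve over the opposite open half of \<open>C\<close>, which meet in the nerve over
  the hyperplane section. Where the coordinate \<open>u\<close> is not positive, \<open>A\<close> still covers.
\<close>
lemma tor_acyclic_pos_complex:
  assumes "rel_open_convex C" "\<And>x. x \<in> C \<Longrightarrow> \<exists>v\<in>A. x v > 0"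
  shows "tor_acyclic (pos_complex C A)"
  using finite[of A] assms
proof (induction A arbitrary: C rule: finite_induct)
  case empty
  then have "pos_complex C {} = {}"
    by (auto simp: pos_complex_def)
  then show ?case
    by (simp add: tor_acyclic_empty)
next
  case (insert u A)
  show ?case
  proof (cases "\<exists>y\<in>C. y u > 0")
    case False
    then have "pos_complex C (insert u A) = pos_complex C A"
      by (auto simp: pos_complex_def)
    moreover have "tor_acyclic (pos_complex C A)"
      using insert.prems False by (intro insert.IH) auto
    ultimately show ?thesis
      by simp
  next
    case True
    then obtain y where y: "y \<in> C" "y u > 0"
      by blast
    note split = pos_complex_insert[OF insert.prems(1) insert.hyps(2) y]
    have "{x \<in> C. x u < 0} = {x \<in> C. - 1 * x u > 0}"
      by simp
    then have "rel_open_convex {x \<in> C. x u < 0}"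
      using rel_open_convex_open_half[OF insert.prems(1), of "- 1" u] by metis
    then have "tor_acyclic (pos_complex {x \<in> C. x u < 0} A)"
      using insert.prems(2) by (intro insert.IH) fastforce+
    moreover have "tor_acyclic (pos_complex {x \<in> C. x u = 0} A)"
      using insert.prems by (intro insert.IH rel_open_convex_hyperplane) fastforce+
    ultimately show ?thesis
      unfolding split(1)
      by (intro tor_acyclic_Un down_closed_UN_Pow down_closed_pos_complex tor_acyclic_star)
        (simp_all only: split(2))
  qed
qed

text \<open>
  Starting from the simplex \<open>\<sigma>\<close>, the vertices outside \<open>\<sigma>\<close> are attached one at a time. Attaching
  \<open>v\<close> glues in the cone over its link, and the link is the nerve over the half-space of \<open>v\<close>. The
  hypothesis \<open>balanced\<close> says that the half-spaces of \<open>\<sigma>\<close> alone cover this half-space, so every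
  link is acyclic.
\<close>
lemma tor_acyclic_Pow_Un_pos_complex:
  assumes L: "rel_open_convex L" and nonempty: "\<sigma> \<noteq> {}"
    and balanced: "\<And>x v. x \<in> L \<Longrightarrow> v \<notin> \<sigma> \<Longrightarrow> x v > 0 \<Longrightarrow> \<exists>w\<in>\<sigma>. x w > 0"
  shows "tor_acyclic (Pow \<sigma> \<union> pos_complex L UNIV)"
proof -
  have "tor_acyclic (Pow \<sigma> \<union> pos_complex L (\<sigma> \<union> M))" if "M \<inter> \<sigma> = {}" for M
    using finite[of M] that
  proof (induction M rule: finite_induct)
    case empty
    have "Pow \<sigma> \<union> pos_complex L (\<sigma> \<union> {}) = Pow \<sigma>"
      by (auto simp: pos_complex_def)
    then show ?case
      using tor_acyclic_Pow[OF nonempty] by simp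
  next
    case (insert v M)
    let ?X = "Pow \<sigma> \<union> pos_complex L (\<sigma> \<union> M)"
    let ?link = "pos_complex {x \<in> L. x v > 0} (\<sigma> \<union> M)"
    let ?star = "\<Union>\<tau>\<in>insert v ` ?link. Pow \<tau>"
    have "rel_open_convex {x \<in> L. x v > 0}"
      using rel_open_convex_open_half[OF L, of 1 v] by simp
    then have link: "tor_acyclic ?link"
      using balanced insert.prems by (intro tor_acyclic_pos_complex) fastforce+
    have star: "P \<in> ?star \<longleftrightarrow> P - {v} \<in> ?link" for P
      by (rule in_star_iff[OF down_closed_pos_complex])
    have inter: "?X \<inter> ?star = ?link"
    proof (intro equalityI subsetI)
      fix P assume P: "P \<in> ?X \<inter> ?star"
      then have "v \<notin> P"
        using insert.hyps insert.prems by (auto simp: pos_complex_def)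
      then show "P \<in> ?link"
        using P star[of P] by simp
    qed (auto simp: pos_complex_def)
    have union: "Pow \<sigma> \<union> pos_complex L (\<sigma> \<union> insert v M) = ?X \<union> ?star"
    proof (intro equalityI subsetI)
      fix P assume P: "P \<in> Pow \<sigma> \<union> pos_complex L (\<sigma> \<union> insert v M)"
      then have "P - {v} \<in> ?link" if "v \<in> P" "v \<notin> \<sigma>"
        using that by (auto simp: pos_complex_def)
      then have "P \<in> ?star" if "v \<in> P"
        using star[of P] that insert.prems by simp
      moreover have "P \<in> ?X" if "v \<notin> P"
        using P that by (auto simp: pos_complex_def)
      ultimately show "P \<in> ?X \<union> ?star"
        by blast
    next
      fix P assume "P \<in> ?X \<union> ?star"
      then show "P \<in> Pow \<sigma> \<union> pos_complex L (\<sigma> \<union> insert v M)"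
        by (auto simp: pos_complex_def)
    qed
    have "tor_acyclic ?X"
      using insert by simp
    moreover have "down_closed ?X"
      by (intro down_closed_Un down_closed_Pow down_closed_pos_complex)
    ultimately have "tor_acyclic (?X \<union> ?star)"
      using link by (intro tor_acyclic_Un[OF _ down_closed_UN_Pow _ tor_acyclic_star])
        (simp_all only: inter)
    then show ?case
      by (simp only: union)
  qed
  from this[of "- \<sigma>"] show ?thesis
    by (simp add: Compl_partition)
qed

end

section \<open>Polynomials on the cube\<close>

lemma eval_mpoly_eq_sum:
  assumes "finite A" "Poly_Mapping.keys p \<subseteq> A"
  shows "eval_mpoly a p = (\<Sum>m\<in>A. Poly_Mapping.lookup p m * (\<Prod>v\<in>UNIV. a v ^ Poly_Mapping.lookup m v))"
  unfolding eval_mpoly_def using assms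
  by (intro sum.mono_neutral_left) (auto simp: in_keys_iff)

lemma lookup_const_mult:
  fixes p :: "('v, 'k::comm_semiring_1) mpoly"
  shows "Poly_Mapping.lookup (Poly_Mapping.single 0 c * p) m = c * Poly_Mapping.lookup p m"
  using lookup_single_mult_add[of 0 c p m] by simp

lemma eval_mpoly_lincomb:
  fixes p q :: "('v::finite, 'k::comm_semiring_1) mpoly"
  shows "eval_mpoly a (Poly_Mapping.single 0 c * p + Poly_Mapping.single 0 d * q) =
    c * eval_mpoly a p + d * eval_mpoly a q"
proof -
  let ?A = "Poly_Mapping.keys p \<union> Poly_Mapping.keys q"
  have "Poly_Mapping.keys (Poly_Mapping.single 0 c * p + Poly_Mapping.single 0 d * q) \<subseteq> ?A"
    by (auto simp: in_keys_iff lookup_add lookup_const_mult)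
  then show ?thesis
    by (simp add: eval_mpoly_eq_sum[of ?A] lookup_add lookup_const_mult sum.distrib
        sum_distrib_left distrib_right mult.assoc)
qed

lemma total_degree_le_lincomb:
  fixes p q :: "('v::finite, 'k::comm_semiring_1) mpoly"
  assumes "total_degree_le p n" "total_degree_le q n"
  shows "total_degree_le (Poly_Mapping.single 0 c * p + Poly_Mapping.single 0 d * q) n"
proof -
  have "Poly_Mapping.keys (Poly_Mapping.single 0 c * p + Poly_Mapping.single 0 d * q) \<subseteq>
      Poly_Mapping.keys p \<union> Poly_Mapping.keys q"
    by (auto simp: in_keys_iff lookup_add lookup_const_mult)
  then show ?thesis
    using assms unfolding total_degree_le_def by blast
qed

lemma total_degree_le_1: "total_degree_le 1 n" and eval_mpoly_1: "eval_mpoly a 1 = 1"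
  by (simp_all add: total_degree_le_def eval_mpoly_def)

lemma sign_val_cases: "sign_val s = 1 \<or> sign_val s = - 1"
  using sign_val[of s] by auto

lemma sign_val_Sign: "sign_val (Sign 1) = 1" "sign_val (Sign (- 1)) = - 1"
  by (simp_all add: Sign_inverse)

lemma sum_sign: "(\<Sum>s\<in>UNIV. g s) = g (Sign 1) + g (Sign (- 1))"
proof -
  have U: "(UNIV :: sign set) = {Sign 1, Sign (- 1)}"
    by (intro equalityI subsetI) (use sign_val_cases in \<open>auto simp: sign_val_inject[symmetric] sign_val_Sign\<close>)
  have "Sign 1 \<noteq> Sign (- 1)"
    by (simp add: sign_val_inject[symmetric] sign_val_Sign)
  then show ?thesis
    unfolding U by simp
qed

lemma sum_cube_prod:
  fixes h :: "'n::finite \<Rightarrow> sign \<Rightarrow> 'a::comm_semiring_1"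
  shows "(\<Sum>u\<in>UNIV. \<Prod>i\<in>UNIV. h i (u i)) = (\<Prod>i\<in>UNIV. h i (Sign 1) + h i (Sign (- 1)))"
proof -
  have "PiE UNIV (\<lambda>_ :: 'n. UNIV :: sign set) = UNIV"
    by (auto simp: PiE_def extensional_def)
  then show ?thesis
    using prod_sum_PiE[of "UNIV :: 'n set" "\<lambda>_. UNIV :: sign set" h] by (simp add: sum_sign)
qed

abbreviation cube_eval :: "('n::finite, real) mpoly \<Rightarrow> ('n \<Rightarrow> sign) \<Rightarrow> real" where
  "cube_eval p u \<equiv> eval_mpoly (\<lambda>i. real_of_int (sign_val (u i))) p"

text \<open>A monomial of degree less than the dimension omits some variable; after multiplication by
  parity that variable occurs to the first power, and the sum over its two values vanishes.\<close>
lemma parity_orthogonal: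
  fixes p :: "('n::finite, real) mpoly"
  assumes "total_degree_le p k" "k < CARD('n)"
  shows "(\<Sum>u\<in>UNIV. real_of_int (sign_val (parity u)) * cube_eval p u) = 0"
proof -
  have zero: "(\<Sum>u\<in>UNIV. \<Prod>i\<in>UNIV. real_of_int (sign_val (u i)) ^ Suc (Poly_Mapping.lookup m i)) = 0"
    if "m \<in> Poly_Mapping.keys p" for m
  proof -
    have "\<exists>i. Poly_Mapping.lookup m i = 0"
    proof (rule ccontr)
      assume "\<nexists>i. Poly_Mapping.lookup m i = 0"
      then have "(\<Sum>i\<in>(UNIV :: 'n set). 1) \<le> (\<Sum>i\<in>UNIV. Poly_Mapping.lookup m i)"
        by (intro sum_mono) (simp add: Suc_le_eq)
      then show False
        using assms that by (auto simp: total_degree_le_def)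
    qed
    then obtain i where "Poly_Mapping.lookup m i = 0"
      by blast
    then show ?thesis
      by (subst sum_cube_prod[of "\<lambda>i s. real_of_int (sign_val s) ^ Suc (Poly_Mapping.lookup m i)"])
        (auto simp: sign_val_Sign prod_zero_iff intro!: exI[of _ i])
  qed
  have "(\<Sum>u\<in>UNIV. real_of_int (sign_val (parity u)) * cube_eval p u) =
      (\<Sum>m\<in>Poly_Mapping.keys p. Poly_Mapping.lookup p m *
        (\<Sum>u\<in>UNIV. \<Prod>i\<in>UNIV. real_of_int (sign_val (u i)) ^ Suc (Poly_Mapping.lookup m i)))"
    unfolding eval_mpoly_def sum_distrib_left
    by (subst sum.swap) (simp add: sign_val_parity prod.distrib mult.left_commute)
  then show ?thesis
    by (simp add: zero del: power_Suc)
qed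

section \<open>Polynomial threshold functions together with parity\<close>

text \<open>Coordinates are indexed by the vertices of the complex, so that positivity of the
  coordinate \<open>(u, s)\<close> means that the polynomial has sign \<open>s\<close> at \<open>u\<close>.\<close>
definition poly_vectors :: "nat \<Rightarrow> (('n::finite \<Rightarrow> sign) \<times> sign \<Rightarrow> real) set" where
  "poly_vectors k = {x. \<exists>p. total_degree_le p k \<and> x = (\<lambda>(u, s). sign_val s * cube_eval p u)}"

lemma rel_open_convex_poly_vectors:
  "rel_open_convex (poly_vectors k :: (('n::finite \<Rightarrow> sign) \<times> sign \<Rightarrow> real) set)"
  unfolding rel_open_convex_def
proof (intro ballI exI[of _ 1] conjI allI impI)
  fix x y :: "('n \<Rightarrow> sign) \<times> sign \<Rightarrow> real" and t :: real
  assume "x \<in> poly_vectors k" "y \<in> poly_vectors k"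
  then obtain p q :: "('n, real) mpoly" where p: "total_degree_le p k" "total_degree_le q k"
      "x = (\<lambda>(u, s). sign_val s * cube_eval p u)" "y = (\<lambda>(u, s). sign_val s * cube_eval q u)"
    by (auto simp: poly_vectors_def)
  let ?r = "Poly_Mapping.single 0 (1 - t) * p + Poly_Mapping.single 0 t * q"
  have "(\<lambda>v. (1 - t) * x v + t * y v) = (\<lambda>(u, s). sign_val s * cube_eval ?r u)"
    unfolding p eval_mpoly_lincomb by (simp add: fun_eq_iff algebra_simps)
  then show "(\<lambda>v. (1 - t) * x v + t * y v) \<in> poly_vectors k"
    using total_degree_le_lincomb[OF p(1,2)] unfolding poly_vectors_def by blast
qed simp

text \<open>A partial sign pattern realised by a polynomial extends to a threshold function: a small
  positive constant added to the polynomial removes its zeros on the cube and keeps its nonzero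
  signs, without raising the degree bound.\<close>
lemma Union_polythr_eq_pos_complex:
  "(\<Union>f\<in>polythr k. Pow (Map.graph (\<lambda>u. Some (f u)))) =
    pos_complex (poly_vectors k) (UNIV :: (('n::finite \<Rightarrow> sign) \<times> sign) set)"
proof (intro equalityI subsetI)
  fix P :: "(('n \<Rightarrow> sign) \<times> sign) set"
  assume "P \<in> (\<Union>f\<in>polythr k. Pow (Map.graph (\<lambda>u. Some (f u))))"
  then obtain f and p :: "('n, real) mpoly"
    where P: "P \<subseteq> Map.graph (\<lambda>u. Some (f u))" and p: "total_degree_le p k"
      "\<And>u. cube_eval p u \<noteq> 0" "\<And>u. real_of_int (sign_val (f u)) = sgn (cube_eval p u)"
    unfolding polythr_def by blast
  have "sign_val s * cube_eval p u > 0" if "(u, s) \<in> P" for u s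
  proof -
    have "s = f u"
      using P that by (auto simp: Map.graph_def)
    then have "sign_val s * cube_eval p u = \<bar>cube_eval p u\<bar>"
      using p(3)[of u] by (simp add: abs_sgn mult.commute)
    then show ?thesis
      using p(2)[of u] by simp
  qed
  moreover have "(\<lambda>(u, s). sign_val s * cube_eval p u) \<in> poly_vectors k"
    using p(1) unfolding poly_vectors_def by blast
  ultimately show "P \<in> pos_complex (poly_vectors k) UNIV"
    unfolding pos_complex_def
    by (intro CollectI conjI bexI[of _ "\<lambda>(u, s). sign_val s * cube_eval p u"]) auto
next
  fix P :: "(('n \<Rightarrow> sign) \<times> sign) set"
  assume "P \<in> pos_complex (poly_vectors k) UNIV"
  then obtain p :: "('n, real) mpoly" where p: "total_degree_le p k"
      and P: "\<And>u s. (u, s) \<in> P \<Longrightarrow> sign_val s * cube_eval p u > 0"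
    unfolding pos_complex_def poly_vectors_def by fastforce
  let ?a = "\<lambda>(u, s). real_of_int (sign_val s) * cube_eval p u"
  let ?b = "\<lambda>(u :: 'n \<Rightarrow> sign, s). real_of_int (sign_val s)"
  obtain \<eta> where \<eta>: "\<eta> > 0" "\<And>t v. \<bar>t\<bar> \<le> \<eta> \<Longrightarrow> v \<in> {v. ?a v > 0} \<Longrightarrow> ?a v + t * ?b v > 0"
    by (rule small_perturbation_pos[of "{v. ?a v > 0}" ?a ?b]) simp_all
  define q where "q = Poly_Mapping.single 0 1 * p + Poly_Mapping.single 0 \<eta> * 1"
  have q: "cube_eval q u = cube_eval p u + \<eta>" for u
    unfolding q_def eval_mpoly_lincomb by (simp add: eval_mpoly_1)
  have same: "sign_val s * cube_eval q u > 0" if "sign_val s * cube_eval p u > 0" for u s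
    using \<eta>(2)[of \<eta> "(u, s)"] \<eta>(1) that by (simp add: q algebra_simps)
  have nonzero: "cube_eval q u \<noteq> 0" for u
  proof (cases "cube_eval p u = 0")
    case False
    then have "cube_eval p u > 0 \<or> cube_eval p u < 0"
      by linarith
    then show ?thesis
      using same[of "Sign 1" u] same[of "Sign (- 1)" u] by (auto simp: sign_val_Sign)
  qed (use q \<eta>(1) in simp)
  define f where "f u = (if cube_eval q u > 0 then Sign 1 else Sign (- 1))" for u
  have "real_of_int (sign_val (f u)) = sgn (cube_eval q u)" for u
    using nonzero[of u] by (auto simp: f_def sign_val_Sign sgn_if)
  moreover have "total_degree_le q k"
    unfolding q_def by (intro total_degree_le_lincomb p total_degree_le_1)
  ultimately have "f \<in> polythr k"
    unfolding polythr_def using nonzero by blast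
  moreover have "P \<subseteq> Map.graph (\<lambda>u. Some (f u))"
  proof clarify
    fix u s assume "(u, s) \<in> P"
    then have "sign_val s * cube_eval q u > 0"
      by (intro same P)
    then have "sign_val s = sign_val (f u)"
      using sign_val_cases[of s] by (auto simp: f_def sign_val_Sign)
    then show "(u, s) \<in> Map.graph (\<lambda>u. Some (f u))"
      by (simp add: Map.graph_def sign_val_inject)
  qed
  ultimately show "P \<in> (\<Union>f\<in>polythr k. Pow (Map.graph (\<lambda>u. Some (f u))))"
    by blast
qed

text \<open>A polynomial that disagrees in sign with parity at some point must agree with it at
  another, since the products of the two sum to zero.\<close>
lemma poly_vectors_balanced:
  fixes x :: "('n::finite \<Rightarrow> sign) \<times> sign \<Rightarrow> real"
  assumes k: "k < CARD('n)" and x: "x \<in> poly_vectors k"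
    and v: "v \<notin> Map.graph (\<lambda>u. Some (parity u))" "x v > 0"
  shows "\<exists>w\<in>Map.graph (\<lambda>u. Some (parity u)). x w > 0"
proof -
  obtain p :: "('n, real) mpoly" where p: "total_degree_le p k"
      and x_eq: "x = (\<lambda>(u, s). sign_val s * cube_eval p u)"
    using x by (auto simp: poly_vectors_def)
  obtain u s where us: "v = (u, s)"
    by fastforce
  have "s \<noteq> parity u"
    using v(1) by (auto simp: us Map.graph_def)
  then have "sign_val s = - sign_val (parity u)"
    using sign_val_cases[of s] sign_val_cases[of "parity u"] sign_val_inject[of s "parity u"] by auto
  then have neg: "sign_val (parity u) * cube_eval p u < 0"
    using v(2) by (simp add: us x_eq)
  have "\<exists>w. sign_val (parity w) * cube_eval p w > 0"
  proof (rule ccontr)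
    assume "\<nexists>w. sign_val (parity w) * cube_eval p w > 0"
    then have "(\<Sum>w\<in>UNIV. sign_val (parity w) * cube_eval p w) < (\<Sum>w\<in>(UNIV :: ('n \<Rightarrow> sign) set). 0)"
      using neg by (intro sum_strict_mono_ex1) (auto simp: not_less)
    then show False
      using parity_orthogonal[OF p k] by simp
  qed
  then show ?thesis
    by (auto simp: x_eq Map.graph_def)
qed

theorem theorem3p40:
  fixes k :: nat
  assumes "k < CARD('n::finite)"
  shows "\<forall>i. betti TYPE('k::field) i Map.empty
           (polythr k \<union> {parity :: ('n \<Rightarrow> sign) \<Rightarrow> sign}) = 0"
proof
  fix i
  let ?par = "Map.graph (\<lambda>u. Some ((parity :: ('n \<Rightarrow> sign) \<Rightarrow> sign) u))"
  let ?K = "Pow ?par \<union> pos_complex (poly_vectors k) UNIV"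
  have "canonical_ideal (polythr k \<union> {parity :: ('n \<Rightarrow> sign) \<Rightarrow> sign}) =
      (complex_ideal ?K :: (('n \<Rightarrow> sign) \<times> sign, 'k) mpoly set)"
    unfolding canonical_ideal_eq UN_Un Union_polythr_eq_pos_complex by (simp add: Un_commute)
  moreover have "tor_dim i (complex_ideal ?K :: (('n \<Rightarrow> sign) \<times> sign, 'k) mpoly set) (squarefree_deg UNIV) = 0"
  proof (rule tor_dim_eq_0)
    fix R :: "(('n \<Rightarrow> sign) \<times> sign, 'k) graded_complex"
    assume "residue_resolution R"
    then interpret residue_resolution R .
    show "tor_acyclic ?K"
    proof (rule tor_acyclic_Pow_Un_pos_complex[OF rel_open_convex_poly_vectors])
      show "?par \<noteq> {}"
        by (auto simp: Map.graph_def)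
    qed (rule poly_vectors_balanced[OF assms])
  qed (intro down_closed_Un down_closed_Pow down_closed_pos_complex)
  moreover have "Gam (Map.empty :: ('n \<Rightarrow> sign) \<rightharpoonup> sign) = UNIV"
    by (simp add: Gam_def)
  ultimately show "betti TYPE('k::field) i Map.empty
      (polythr k \<union> {parity :: ('n \<Rightarrow> sign) \<Rightarrow> sign}) = 0"
    by (simp add: betti_def)
qed

end
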